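(* Let $\gamma\in(0,1)$, let $d\ge 1$ and $n\ge 2$ be integers, let $p_0\in\mathcal{P}_d$ and let $\alpha\in(0,1]$. Then for every nonempty subset $B\subseteq[d]$, the non-interactive $\alpha$-LDP minimax testing radii based on a total sample of size $2n$ satisfy \[ \mathcal{E}^{\mathrm{NI}}_{2n,\alpha}(p_0,\mathbb{L}_1)\le 8\max\biggl[12\Bigl\{\frac{|B|^3}{n(n-1)\alpha^4\gamma^2}\Bigr\}^{1/4},\; p_0(B^c)\biggr] \] and \[ \mathcal{E}^{\mathrm{NI}}_{2n,\alpha}(p_0,\mathbb{L}_2)\le 8\max\biggl[12\Bigl\{\frac{|B|}{n(n-1)\alpha^4\gamma^2}\Bigr\}^{1/4},\; p_0(B^c)\biggr], \] where $B^c=[d]\setminus B$ and $p_0(B^c)=\sum_{j\in B^c}p_0(j)$.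
   Context: $[d]=\{1,\dots,d\}$ and $\mathcal{P}_d=\{p\in[0,1]^d:\sum_{j=1}^d p(j)=1\}$. For $N\ge 1$, data $X_1,\dots,X_N$ are i.i.d. with $\mathbb{P}(X_i=j)=p(j)$ for an unknown $p\in\mathcal{P}_d$. For $r\in\{1,2\}$ let $\|\cdot\|_r$ be the $\ell_r$ norm on $\mathbb{R}^d$ and, for $\delta>0$, $H_1(\delta,\mathbb{L}_r)=\{p\in\mathcal{P}_d:\|p-p_0\|_r\ge\delta\}$; the null hypothesis is $p=p_0$. A (sequentially interactive) $\alpha$-LDP privacy mechanism $Q$ for $N$ samples generates private data $Z_1,\dots,Z_N$ in a measurable space $\mathcal{Z}$ successively, where $Z_i$ is drawn from a conditional distribution (Markov kernel) $Q_i(\cdot\mid x_i,z_1,\dots,z_{i-1})$ given $X_i=x_i$ and $Z_1=z_1,\dots,Z_{i-1}=z_{i-1}$, with \[ Q_i(A\mid x,z_1,\dots,z_{i-1})\le e^{\alpha}\,Q_i(A\mid x',z_1,\dots,z_{i-1}) \] for all measurable $A$, all $z_1,\dots,z_{i-1}$, all $x,x'\in[d]$ and all $i=1,\dots,N$. The mechanism is non-interactive if each $Q_i$ does not depend on $z_1,\dots,z_{i-1}$, i.e. $Z_i\sim Q_i(\cdot\mid X_i)$. The set of $\alpha$-LDP mechanisms is $\mathcal{Q}_\alpha$ and the subset of non-interactive ones is $\mathcal{Q}^{\mathrm{NI}}_\alpha$. A test is a measurable map $\phi:\mathcal{Z}^N\to[0,1]$ of $(Z_1,\dots,Z_N)$;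 $\Phi_Q$ is the set of tests, and $\mathbb{E}_p$ denotes expectation when the $X_i$ are i.i.d. from $p$ and privatized by $Q$. Risks and radii (with $\sup\emptyset=0$): \[ \mathcal{R}_N(p_0,\delta,Q,\mathbb{L}_r)=\inf_{\phi\in\Phi_Q}\sup_{p\in H_1(\delta,\mathbb{L}_r)}\{\mathbb{E}_{p_0}(\phi)+\mathbb{E}_p(1-\phi)\}, \] $\mathcal{R}^{\mathrm{NI}}_{N,\alpha}(p_0,\delta,\mathbb{L}_r)=\inf_{Q\in\mathcal{Q}^{\mathrm{NI}}_\alpha}\mathcal{R}_N(p_0,\delta,Q,\mathbb{L}_r)$, and, for the fixed level $\gamma\in(0,1)$, $\mathcal{E}^{\mathrm{NI}}_{N,\alpha}(p_0,\mathbb{L}_r)=\inf\{\delta>0:\mathcal{R}^{\mathrm{NI}}_{N,\alpha}(p_0,\delta,\mathbb{L}_r)\le\gamma\}$. *)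

theory Defs
  imports "HOL-Probability.Probability"
begin

text \<open>
  Vectors in \<open>\<real>\<^sup>d\<close> are functions of type \<^typ>\<open>nat \<Rightarrow> real\<close> of which only the values on \<open>{1..d}\<close> matter.
\<close>

definition prob_vectors :: "nat \<Rightarrow> (nat \<Rightarrow> real) set" where
  "prob_vectors d = {p. (\<forall>j\<in>{1..d}. 0 \<le> p j \<and> p j \<le> 1) \<and> (\<Sum>j=1..d. p j) = 1}"

definition lr_norm :: "nat \<Rightarrow> nat \<Rightarrow> (nat \<Rightarrow> real) \<Rightarrow> real" where
  "lr_norm d r x = root r (\<Sum>j=1..d. \<bar>x j\<bar> ^ r)"

definition alternatives :: "nat \<Rightarrow> nat \<Rightarrow> (nat \<Rightarrow> real) \<Rightarrow> real \<Rightarrow> (nat \<Rightarrow> real) set" where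
  "alternatives d r p0 \<delta> = {p \<in> prob_vectors d. \<delta> \<le> lr_norm d r (\<lambda>j. p j - p0 j)}"

definition data_law :: "nat \<Rightarrow> (nat \<Rightarrow> real) \<Rightarrow> nat measure" where
  "data_law d p = point_measure {1..d} (\<lambda>j. ennreal (p j))"

text \<open>
  A mechanism is a pair \<open>(Z, Q)\<close> of a measurable space \<open>Z\<close>, carried by an arbitrary subset of the
  type \<^typ>\<open>'z\<close>, and a family of conditional distributions. The measure \<open>Q i (x, z)\<close> is the
  distribution of the private observation \<open>i\<close> given that the raw observation \<open>i\<close> is \<open>x\<close> and that
  the earlier private observations are \<open>z 1, \<dots>, z (i - 1)\<close>. Since every \<open>Q i (x, z)\<close> is required
  to be a probability measure on \<open>Z\<close>, the space \<open>Z\<close> is automatically nonempty when \<open>N, d \<ge> 1\<close>.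

  An infimum over mechanisms in HOL ranges over the measurable spaces carried by one type \<^typ>\<open>'z\<close>,
  so the minimax risk and radius below take that type as an argument. Statements about them are
  meant for all infinite \<^typ>\<open>'z\<close>; a finite type bounds the number of outcomes of a mechanism.
\<close>

type_synonym 'z mechanism = "'z measure \<times> (nat \<Rightarrow> nat \<times> (nat \<Rightarrow> 'z) \<Rightarrow> 'z measure)"

definition ldp_mechanisms :: "nat \<Rightarrow> nat \<Rightarrow> real \<Rightarrow> 'z mechanism set" where
  "ldp_mechanisms d N \<alpha> =
    {(Z, Q). \<forall>i\<in>{1..N}.
       Q i \<in> measurable (count_space {1..d} \<Otimes>\<^sub>M PiM {1..<i} (\<lambda>_. Z)) (prob_algebra Z) \<and>
       (\<forall>z\<in>space (PiM {1..<i} (\<lambda>_. Z)). \<forall>x\<in>{1..d}. \<forall>x'\<in>{1..d}. \<forall>A\<in>sets Z.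
          measure (Q i (x, z)) A \<le> exp \<alpha> * measure (Q i (x', z)) A)}"

definition ni_ldp_mechanisms :: "nat \<Rightarrow> nat \<Rightarrow> real \<Rightarrow> 'z mechanism set" where
  "ni_ldp_mechanisms d N \<alpha> =
    {(Z, Q) \<in> ldp_mechanisms d N \<alpha>.
       \<forall>i\<in>{1..N}. \<forall>x\<in>{1..d}. \<forall>z\<in>space (PiM {1..<i} (\<lambda>_. Z)). \<forall>z'\<in>space (PiM {1..<i} (\<lambda>_. Z)).
         Q i (x, z) = Q i (x, z')}"

text \<open>
  The joint law of the first \<open>k\<close> private observations, as a measure on \<open>Z\<^sup>k\<close>, when the raw
  observations are i.i.d. from \<open>p\<close>: given the first \<open>k\<close> private observations \<open>z\<close>, a fresh raw
  observation \<open>x\<close> is drawn from \<open>p\<close>, and then the next private one from \<open>Q (k + 1) (x, z)\<close>.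
\<close>

primrec private_law :: "nat \<Rightarrow> (nat \<Rightarrow> real) \<Rightarrow> 'z mechanism \<Rightarrow> nat \<Rightarrow> (nat \<Rightarrow> 'z) measure" where
  "private_law d p M 0 = return (PiM {1..0} (\<lambda>_. fst M)) (\<lambda>_. undefined)"
| "private_law d p M (Suc k) =
     private_law d p M k \<bind> (\<lambda>z. data_law d p \<bind> (\<lambda>x.
       distr (snd M (Suc k) (x, z)) (PiM {1..Suc k} (\<lambda>_. fst M)) (\<lambda>y. z(Suc k := y))))"

definition tests :: "nat \<Rightarrow> 'z mechanism \<Rightarrow> ((nat \<Rightarrow> 'z) \<Rightarrow> real) set" where
  "tests N M =
    {\<phi> \<in> borel_measurable (PiM {1..N} (\<lambda>_. fst M)).
       \<forall>z\<in>space (PiM {1..N} (\<lambda>_. fst M)). 0 \<le> \<phi> z \<and> \<phi> z \<le> 1}"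

text \<open>
  Risks and radii take values in \<^typ>\<open>ennreal\<close>, where the supremum of the empty set is \<open>0\<close> and the
  infimum of the empty set is \<open>\<infinity>\<close>.
\<close>

definition test_risk ::
  "nat \<Rightarrow> nat \<Rightarrow> nat \<Rightarrow> (nat \<Rightarrow> real) \<Rightarrow> real \<Rightarrow> 'z mechanism \<Rightarrow> ennreal" where
  "test_risk d N r p0 \<delta> M =
    (INF \<phi>\<in>tests N M. SUP p\<in>alternatives d r p0 \<delta>.
       ennreal ((\<integral>z. \<phi> z \<partial>private_law d p0 M N) + (\<integral>z. 1 - \<phi> z \<partial>private_law d p M N)))"

definition ni_minimax_risk ::
  "'z itself \<Rightarrow> nat \<Rightarrow> nat \<Rightarrow> real \<Rightarrow> nat \<Rightarrow> (nat \<Rightarrow> real) \<Rightarrow> real \<Rightarrow> ennreal" where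
  "ni_minimax_risk _ d N \<alpha> r p0 \<delta> =
    (INF M\<in>(ni_ldp_mechanisms d N \<alpha> :: 'z mechanism set). test_risk d N r p0 \<delta> M)"

definition ni_testing_radius ::
  "'z itself \<Rightarrow> real \<Rightarrow> nat \<Rightarrow> nat \<Rightarrow> real \<Rightarrow> nat \<Rightarrow> (nat \<Rightarrow> real) \<Rightarrow> ennreal" where
  "ni_testing_radius t \<gamma> d N \<alpha> r p0 =
    (INF \<delta>\<in>{\<delta>. 0 < \<delta> \<and> ni_minimax_risk t d N \<alpha> r p0 \<delta> \<le> ennreal \<gamma>}. ennreal \<delta>)"

end

theory Submission
  imports Defs
begin

text \<open>
  Collapse the complement of \<open>B\<close> to a single cell, leaving \<open>m = |B| + 1\<close> cells. Each user in cell \<open>i\<close>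
  releases a vector of \<open>m\<close> random signs with law \<open>(1 + \<tau> \<epsilon>\<^sub>i) / 2\<^sup>m\<close>. For \<open>\<tau> = \<alpha> / 3\<close> this is
  \<open>\<alpha>\<close>-private, the mean of the signs is \<open>\<tau>\<close> times the vector \<open>q\<close> of cell probabilities, and their second
  moment matrix is the identity whatever \<open>q\<close> is, so that \<open>\<epsilon> / \<tau>\<close> has covariance at most \<open>I / \<tau>\<^sup>2\<close>.
  The inner product of the centred averages over the two halves of the sample is then an
  unbiased estimator of \<open>s = \<parallel>q - q\<^sub>0\<parallel>\<^sup>2\<close> with variance at most \<open>2 s / (n \<tau>\<^sup>2) + m / (n\<^sup>2 \<tau>\<^sup>4)\<close>, and Chebyshev's
  inequality separates \<open>s = 0\<close> from \<open>s\<close> of order \<open>\<surd>m / (n \<alpha>\<^sup>2 \<gamma>)\<close>. The distance of \<open>p\<close> and \<open>p\<^sub>0\<close>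
  is at most a constant times that of the collapsed vectors plus a multiple of \<open>p\<^sub>0(B\<^sup>c)\<close>, which the second
  term of the maximum absorbs.
\<close>

subsection \<open>Moments of an inner product of independent sums\<close>

context prob_space
begin

lemma expectation_mult_of_indep_vars:
  fixes g h :: "'z \<Rightarrow> real"
  assumes indep: "indep_vars (\<lambda>_. N) X A" and ij: "i \<in> A" "j \<in> A" "i \<noteq> j"
    and g [measurable]: "g \<in> borel_measurable N" and h [measurable]: "h \<in> borel_measurable N"
    and int: "integrable M (\<lambda>\<omega>. g (X i \<omega>))" "integrable M (\<lambda>\<omega>. h (X j \<omega>))"
  shows "expectation (\<lambda>\<omega>. g (X i \<omega>) * h (X j \<omega>)) =
      expectation (\<lambda>\<omega>. g (X i \<omega>)) * expectation (\<lambda>\<omega>. h (X j \<omega>))"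
    and "integrable M (\<lambda>\<omega>. g (X i \<omega>) * h (X j \<omega>))"
proof -
  \<comment> \<open>Both functions go into one family on \<open>{i, j}\<close>, to which the product
    rule for independent families applies. As \<open>i \<noteq> j\<close>, the choice of function by
    index is unambiguous.\<close>
  define Y where "Y k \<omega> = (if k = i then g else h) (X k \<omega>)" for k \<omega>
  have "indep_vars (\<lambda>_. N) X {i, j}"
    using indep by (rule indep_vars_subset) (use ij in auto)
  then have Y: "indep_vars (\<lambda>_. borel) Y {i, j}"
    unfolding Y_def by (rule indep_vars_compose2) auto
  have intY: "integrable M (Y k)" if "k \<in> {i, j}" for k
    using that int ij unfolding Y_def by (auto split: if_splits)
  from indep_vars_lebesgue_integral[OF _ Y intY] indep_vars_integrable[OF _ Y intY]
  show "expectation (\<lambda>\<omega>. g (X i \<omega>) * h (X j \<omega>)) =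
      expectation (\<lambda>\<omega>. g (X i \<omega>)) * expectation (\<lambda>\<omega>. h (X j \<omega>))"
    and "integrable M (\<lambda>\<omega>. g (X i \<omega>) * h (X j \<omega>))"
    using ij by (simp_all add: Y_def)
qed

lemma integrable_sum_mult_sum:
  fixes g h :: "'z \<Rightarrow> real"
  assumes indep: "indep_vars (\<lambda>_. N) X A"
    and g: "g \<in> borel_measurable N" and h: "h \<in> borel_measurable N"
    and int: "\<And>i. i \<in> A \<Longrightarrow> integrable M (\<lambda>\<omega>. g (X i \<omega>))"
      "\<And>i. i \<in> A \<Longrightarrow> integrable M (\<lambda>\<omega>. h (X i \<omega>))"
      "\<And>i. i \<in> A \<Longrightarrow> integrable M (\<lambda>\<omega>. g (X i \<omega>) * h (X i \<omega>))"
  shows "integrable M (\<lambda>\<omega>. (\<Sum>i\<in>A. g (X i \<omega>)) * (\<Sum>i\<in>A. h (X i \<omega>)))"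
proof -
  have "integrable M (\<lambda>\<omega>. g (X i \<omega>) * h (X j \<omega>))" if "i \<in> A" "j \<in> A" for i j
    using that int expectation_mult_of_indep_vars(2)[OF indep that _ g h] by (cases "i = j") auto
  then show ?thesis
    unfolding sum_product by (intro Bochner_Integration.integrable_sum)
qed

text \<open>Expand over pairs of indices: every pair contributes \<open>a * b\<close>, and by
  independence only the \<open>card A\<close> diagonal pairs add the covariance
  \<open>c\<close>.\<close>

lemma expectation_sum_mult_sum:
  fixes g h :: "'z \<Rightarrow> real"
  assumes indep: "indep_vars (\<lambda>_. N) X A" and "finite A"
    and g: "g \<in> borel_measurable N" and h: "h \<in> borel_measurable N"
    and int: "\<And>i. i \<in> A \<Longrightarrow> integrable M (\<lambda>\<omega>. g (X i \<omega>))"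
      "\<And>i. i \<in> A \<Longrightarrow> integrable M (\<lambda>\<omega>. h (X i \<omega>))"
      "\<And>i. i \<in> A \<Longrightarrow> integrable M (\<lambda>\<omega>. g (X i \<omega>) * h (X i \<omega>))"
    and mean: "\<And>i. i \<in> A \<Longrightarrow> expectation (\<lambda>\<omega>. g (X i \<omega>)) = a"
      "\<And>i. i \<in> A \<Longrightarrow> expectation (\<lambda>\<omega>. h (X i \<omega>)) = b"
      "\<And>i. i \<in> A \<Longrightarrow> expectation (\<lambda>\<omega>. g (X i \<omega>) * h (X i \<omega>)) = a * b + c"
  shows "expectation (\<lambda>\<omega>. (\<Sum>i\<in>A. g (X i \<omega>)) * (\<Sum>i\<in>A. h (X i \<omega>))) =
      (real (card A))\<^sup>2 * (a * b) + real (card A) * c"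
proof -
  have int2: "integrable M (\<lambda>\<omega>. g (X i \<omega>) * h (X j \<omega>))" if "i \<in> A" "j \<in> A" for i j
    using that int expectation_mult_of_indep_vars(2)[OF indep that _ g h] by (cases "i = j") auto
  have exp2: "expectation (\<lambda>\<omega>. g (X i \<omega>) * h (X j \<omega>)) = a * b + (if i = j then c else 0)"
    if "i \<in> A" "j \<in> A" for i j
    using that int mean expectation_mult_of_indep_vars(1)[OF indep that _ g h] by (cases "i = j") auto
  have "expectation (\<lambda>\<omega>. (\<Sum>i\<in>A. g (X i \<omega>)) * (\<Sum>i\<in>A. h (X i \<omega>))) =
      (\<Sum>i\<in>A. \<Sum>j\<in>A. a * b + (if i = j then c else 0))"
    unfolding sum_product
    by (simp add: Bochner_Integration.integral_sum Bochner_Integration.integrable_sum int2 exp2)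
  also have "\<dots> = (real (card A))\<^sup>2 * (a * b) + real (card A) * c"
    using \<open>finite A\<close> by (simp add: sum.distrib power2_eq_square algebra_simps)
  finally show ?thesis .
qed

text \<open>Functions of disjoint blocks of an independent family are independent. This is what
  makes moments factor over the two halves of the sample.\<close>

lemma expectation_mult_of_disjoint_indep_vars:
  fixes F G :: "('i \<Rightarrow> 'z) \<Rightarrow> real"
  assumes indep: "indep_vars (\<lambda>_. N) X (A \<union> A')" and disj: "A \<inter> A' = {}"
    and F: "F \<in> borel_measurable (PiM A (\<lambda>_. N))" and G: "G \<in> borel_measurable (PiM A' (\<lambda>_. N))"
    and int: "integrable M (\<lambda>\<omega>. F (\<lambda>i\<in>A. X i \<omega>))" "integrable M (\<lambda>\<omega>. G (\<lambda>i\<in>A'. X i \<omega>))"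
  shows "expectation (\<lambda>\<omega>. F (\<lambda>i\<in>A. X i \<omega>) * G (\<lambda>i\<in>A'. X i \<omega>)) =
      expectation (\<lambda>\<omega>. F (\<lambda>i\<in>A. X i \<omega>)) * expectation (\<lambda>\<omega>. G (\<lambda>i\<in>A'. X i \<omega>))"
    and "integrable M (\<lambda>\<omega>. F (\<lambda>i\<in>A. X i \<omega>) * G (\<lambda>i\<in>A'. X i \<omega>))"
proof -
  have "indep_var borel (\<lambda>\<omega>. F (\<lambda>i\<in>A. X i \<omega>)) borel (\<lambda>\<omega>. G (\<lambda>i\<in>A'. X i \<omega>))"
    using indep_var_compose[OF indep_var_restrict[OF indep disj] F G] by (simp add: comp_def)
  from indep_var_lebesgue_integral[OF this int] indep_var_integrable[OF this int]
  show "expectation (\<lambda>\<omega>. F (\<lambda>i\<in>A. X i \<omega>) * G (\<lambda>i\<in>A'. X i \<omega>)) =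
      expectation (\<lambda>\<omega>. F (\<lambda>i\<in>A. X i \<omega>)) * expectation (\<lambda>\<omega>. G (\<lambda>i\<in>A'. X i \<omega>))"
    and "integrable M (\<lambda>\<omega>. F (\<lambda>i\<in>A. X i \<omega>) * G (\<lambda>i\<in>A'. X i \<omega>))" by auto
qed

text \<open>\<open>C\<close> is the covariance matrix of the scores \<open>g\<close>. In the square
  of \<open>T\<close> each product splits into one factor per half; both factors have mean
  \<open>n\<^sup>2 \<mu> j \<mu> k + n C j k\<close>, so this number is squared and summed. Its
  leading part of order \<open>n^4\<close> is the squared mean of \<open>T\<close> and cancels in
  the variance.\<close>

lemma split_inner_product_moments:
  fixes g :: "'j \<Rightarrow> 'z \<Rightarrow> real" and X :: "'i \<Rightarrow> 'a \<Rightarrow> 'z" and C :: "'j \<Rightarrow> 'j \<Rightarrow> real"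
  assumes indep: "indep_vars (\<lambda>_. N) X (A \<union> A')" and disj: "A \<inter> A' = {}"
    and fin: "finite J" "finite A" "finite A'" and card: "card A = n" "card A' = n"
    and g [measurable]: "\<And>j. g j \<in> borel_measurable N"
    and int: "\<And>i j. i \<in> A \<union> A' \<Longrightarrow> integrable M (\<lambda>\<omega>. g j (X i \<omega>))"
      "\<And>i j k. i \<in> A \<union> A' \<Longrightarrow> integrable M (\<lambda>\<omega>. g j (X i \<omega>) * g k (X i \<omega>))"
    and mean: "\<And>i j. i \<in> A \<union> A' \<Longrightarrow> j \<in> J \<Longrightarrow> expectation (\<lambda>\<omega>. g j (X i \<omega>)) = \<mu> j"
      "\<And>i j k. i \<in> A \<union> A' \<Longrightarrow> j \<in> J \<Longrightarrow> k \<in> J \<Longrightarrow>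
        expectation (\<lambda>\<omega>. g j (X i \<omega>) * g k (X i \<omega>)) = \<mu> j * \<mu> k + C j k"
  defines "T \<equiv> \<lambda>\<omega>. \<Sum>j\<in>J. (\<Sum>i\<in>A. g j (X i \<omega>)) * (\<Sum>i\<in>A'. g j (X i \<omega>))"
  shows "integrable M (\<lambda>\<omega>. (T \<omega>)\<^sup>2)" and "T \<in> borel_measurable M"
    and "expectation T = (real n)\<^sup>2 * (\<Sum>j\<in>J. (\<mu> j)\<^sup>2)"
    and "variance T = 2 * real n ^ 3 * (\<Sum>j\<in>J. \<Sum>k\<in>J. \<mu> j * \<mu> k * C j k)
      + (real n)\<^sup>2 * (\<Sum>j\<in>J. \<Sum>k\<in>J. (C j k)\<^sup>2)"
proof -
  define S where "S D j \<omega> = (\<Sum>i\<in>D. g j (X i \<omega>))" for D :: "'i set" and j \<omega>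
  \<comment> \<open>\<open>R\<close> is the block sum as a function of the block of observations,
    the form required for the independence of blocks; \<open>RS\<close> translates back to
    \<open>S\<close>.\<close>
  define R where "R D j w = (\<Sum>i\<in>D. g j (w i))" for D :: "'i set" and j and w :: "'i \<Rightarrow> 'z"
  have RS: "R D j (\<lambda>i\<in>D. X i \<omega>) = S D j \<omega>" for D j \<omega>
    by (simp add: R_def S_def)
  have R_meas [measurable]: "R D j \<in> borel_measurable (PiM D (\<lambda>_. N))" for D j
    unfolding R_def by measurable
  have X_meas [measurable]: "X i \<in> measurable M N" if "i \<in> A \<union> A'" for i
    using indep that unfolding indep_vars_def by auto
  show "T \<in> borel_measurable M"
    unfolding T_def by (intro borel_measurable_sum borel_measurable_times) (auto intro!: measurable_compose[OF X_meas g])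
  have S_int: "integrable M (S D j)" if "D \<subseteq> A \<union> A'" for D j
    unfolding S_def using that by (intro Bochner_Integration.integrable_sum int) auto
  have S_exp: "expectation (S D j) = real n * \<mu> j" if "D \<in> {A, A'}" "j \<in> J" for D j
    using that mean(1) int(1) card unfolding S_def by (auto simp: Bochner_Integration.integral_sum)
  have SS: "integrable M (\<lambda>\<omega>. S D j \<omega> * S D k \<omega>)"
    "j \<in> J \<Longrightarrow> k \<in> J \<Longrightarrow> expectation (\<lambda>\<omega>. S D j \<omega> * S D k \<omega>) = (real n)\<^sup>2 * (\<mu> j * \<mu> k) + real n * C j k"
    if D: "D \<in> {A, A'}" for D j k
  proof -
    have sub: "D \<subseteq> A \<union> A'" and "finite D" "card D = n" using D fin card by auto
    note ind = indep_vars_subset[OF indep sub]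
    show "integrable M (\<lambda>\<omega>. S D j \<omega> * S D k \<omega>)"
      unfolding S_def using sub by (intro integrable_sum_mult_sum[OF ind g g] int) auto
    show "expectation (\<lambda>\<omega>. S D j \<omega> * S D k \<omega>) = (real n)\<^sup>2 * (\<mu> j * \<mu> k) + real n * C j k"
      if "j \<in> J" "k \<in> J"
      unfolding S_def \<open>card D = n\<close>[symmetric] using sub that
      by (intro expectation_sum_mult_sum[OF ind \<open>finite D\<close> g g] int mean) auto
  qed
  have T_eq: "T \<omega> = (\<Sum>j\<in>J. S A j \<omega> * S A' j \<omega>)" for \<omega>
    by (simp add: T_def S_def)
  have prod1: "integrable M (\<lambda>\<omega>. S A j \<omega> * S A' j \<omega>)"
    "expectation (\<lambda>\<omega>. S A j \<omega> * S A' j \<omega>) = expectation (S A j) * expectation (S A' j)" for j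
    using expectation_mult_of_disjoint_indep_vars[OF indep disj R_meas R_meas, of j j]
      S_int[of A j] S_int[of A' j] by (simp_all add: RS)
  define RR where "RR D j k w = R D j w * R D k w" for D j k w
  have RR_meas: "RR D j k \<in> borel_measurable (PiM D (\<lambda>_. N))" for D j k
    unfolding RR_def by measurable
  have prod2: "integrable M (\<lambda>\<omega>. (S A j \<omega> * S A k \<omega>) * (S A' j \<omega> * S A' k \<omega>))"
    "expectation (\<lambda>\<omega>. (S A j \<omega> * S A k \<omega>) * (S A' j \<omega> * S A' k \<omega>)) =
      expectation (\<lambda>\<omega>. S A j \<omega> * S A k \<omega>) * expectation (\<lambda>\<omega>. S A' j \<omega> * S A' k \<omega>)" for j k
    using expectation_mult_of_disjoint_indep_vars[OF indep disj RR_meas RR_meas, of j k j k]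
      SS(1)[of A j k] SS(1)[of A' j k] by (simp_all add: RS RR_def)
  \<comment> \<open>The four factors are regrouped so that each bracket depends on one half
    only.\<close>
  have T2_eq: "(T \<omega>)\<^sup>2 = (\<Sum>j\<in>J. \<Sum>k\<in>J. (S A j \<omega> * S A k \<omega>) * (S A' j \<omega> * S A' k \<omega>))" for \<omega>
    unfolding T_eq power2_eq_square sum_product by (intro sum.cong refl) (simp add: mult_ac)
  show T2_int: "integrable M (\<lambda>\<omega>. (T \<omega>)\<^sup>2)"
    unfolding T2_eq by (intro Bochner_Integration.integrable_sum prod2)
  have T_int: "integrable M T"
    unfolding T_eq by (intro Bochner_Integration.integrable_sum prod1)
  have "expectation T = (\<Sum>j\<in>J. expectation (S A j) * expectation (S A' j))"
    unfolding T_eq by (simp add: Bochner_Integration.integral_sum prod1)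
  also have "\<dots> = (real n)\<^sup>2 * (\<Sum>j\<in>J. (\<mu> j)\<^sup>2)"
    unfolding sum_distrib_left by (intro sum.cong refl) (simp add: S_exp power2_eq_square)
  finally show T_exp: "expectation T = (real n)\<^sup>2 * (\<Sum>j\<in>J. (\<mu> j)\<^sup>2)" .
  have "expectation (\<lambda>\<omega>. (T \<omega>)\<^sup>2) = (\<Sum>j\<in>J. \<Sum>k\<in>J.
      expectation (\<lambda>\<omega>. S A j \<omega> * S A k \<omega>) * expectation (\<lambda>\<omega>. S A' j \<omega> * S A' k \<omega>))"
    unfolding T2_eq
    by (simp add: Bochner_Integration.integral_sum Bochner_Integration.integrable_sum prod2)
  also have "\<dots> = (\<Sum>j\<in>J. \<Sum>k\<in>J. ((real n)\<^sup>2 * (\<mu> j * \<mu> k) + real n * C j k)\<^sup>2)"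
    by (intro sum.cong refl) (simp add: SS power2_eq_square)
  also have "\<dots> = (real n)^4 * (\<Sum>j\<in>J. \<Sum>k\<in>J. (\<mu> j)\<^sup>2 * (\<mu> k)\<^sup>2)
      + 2 * real n ^ 3 * (\<Sum>j\<in>J. \<Sum>k\<in>J. \<mu> j * \<mu> k * C j k)
      + (real n)\<^sup>2 * (\<Sum>j\<in>J. \<Sum>k\<in>J. (C j k)\<^sup>2)"
    unfolding sum_distrib_left sum.distrib[symmetric]
    by (intro sum.cong refl) algebra
  also have "(\<Sum>j\<in>J. \<Sum>k\<in>J. (\<mu> j)\<^sup>2 * (\<mu> k)\<^sup>2) = (\<Sum>j\<in>J. (\<mu> j)\<^sup>2)\<^sup>2"
    by (simp add: power2_eq_square sum_product)
  finally have T2_exp: "expectation (\<lambda>\<omega>. (T \<omega>)\<^sup>2) = real n ^ 4 * (\<Sum>j\<in>J. (\<mu> j)\<^sup>2)\<^sup>2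
      + 2 * real n ^ 3 * (\<Sum>j\<in>J. \<Sum>k\<in>J. \<mu> j * \<mu> k * C j k)
      + (real n)\<^sup>2 * (\<Sum>j\<in>J. \<Sum>k\<in>J. (C j k)\<^sup>2)" .
  have "variance T = expectation (\<lambda>\<omega>. (T \<omega>)\<^sup>2) - (expectation T)\<^sup>2"
    by (rule variance_eq[OF T_int T2_int])
  then show "variance T = 2 * real n ^ 3 * (\<Sum>j\<in>J. \<Sum>k\<in>J. \<mu> j * \<mu> k * C j k)
      + (real n)\<^sup>2 * (\<Sum>j\<in>J. \<Sum>k\<in>J. (C j k)\<^sup>2)"
    unfolding T2_exp by (simp add: T_exp power_mult_distrib)
qed

end

text \<open>The joint law of the coordinates is the product measure itself, and its factors are
  their marginals; this is the product criterion for independence.\<close>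

lemma (in product_prob_space) indep_vars_coordinate:
  assumes "I \<noteq> {}"
  shows "prob_space.indep_vars (PiM I M) M (\<lambda>i \<omega>. \<omega> i) I"
proof -
  have prob: "prob_space (PiM I M)" by (rule prob_space_PiM) unfold_locales
  have "distr (PiM I M) (PiM I M) (\<lambda>\<omega>. \<lambda>i\<in>I. \<omega> i) = distr (PiM I M) (PiM I M) (\<lambda>\<omega>. \<omega>)"
    by (rule distr_cong) (auto simp: space_PiM PiE_restrict)
  also have "\<dots> = PiM I (\<lambda>i. distr (PiM I M) (M i) (\<lambda>\<omega>. \<omega> i))"
    by (simp add: distr_id2 PiM_component cong: PiM_cong)
  finally show ?thesis
    by (subst prob_space.indep_vars_iff_distr_eq_PiM'[OF prob]) (use assms in auto)
qed

subsection \<open>The law of the private observations\<close>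

text \<open>The values of \<open>p\<close> off \<open>{1..d}\<close> are arbitrary, hence the
  cutoff. The pmf form allows mixtures to be written with \<open>bind_pmf\<close>.\<close>

definition data_pmf :: "nat \<Rightarrow> (nat \<Rightarrow> real) \<Rightarrow> nat pmf" where
  "data_pmf d p = embed_pmf (\<lambda>j. if j \<in> {1..d} then p j else 0)"

lemma pmf_data_pmf:
  assumes "p \<in> prob_vectors d"
  shows "pmf (data_pmf d p) j = (if j \<in> {1..d} then p j else 0)"
  unfolding data_pmf_def
proof (rule pmf_embed_pmf)
  show "0 \<le> (if j \<in> {1..d} then p j else 0)" for j
    using assms by (auto simp: prob_vectors_def)
  have "(\<integral>\<^sup>+j. ennreal (if j \<in> {1..d} then p j else 0) \<partial>count_space UNIV) = (\<Sum>j=1..d. ennreal (p j))"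
    by (subst nn_integral_count_space'[of "{1..d}"]) auto
  also have "\<dots> = 1"
    using assms by (subst sum_ennreal) (auto simp: prob_vectors_def)
  finally show "(\<integral>\<^sup>+j. ennreal (if j \<in> {1..d} then p j else 0) \<partial>count_space UNIV) = 1" .
qed

lemma set_data_pmf: "p \<in> prob_vectors d \<Longrightarrow> set_pmf (data_pmf d p) \<subseteq> {1..d}"
  by (auto simp: set_pmf_iff pmf_data_pmf split: if_splits)

lemma space_data_law_nonempty: "p \<in> prob_vectors d \<Longrightarrow> space (data_law d p) \<noteq> {}"
  by (cases d) (auto simp: data_law_def space_point_measure prob_vectors_def)

lemma measurable_data_law_pmf:
  "(\<lambda>x. measure_pmf (K x)) \<in> data_law d p \<rightarrow>\<^sub>M subprob_algebra (count_space UNIV)"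
  by (auto simp: data_law_def measurable_point_measure_eq1 measure_pmf_in_subprob_space)

text \<open>Both sides give \<open>A\<close> the finite mixture of the masses \<open>K x A\<close>
  with weights \<open>p x\<close>. This turns the draw of a raw observation followed by its
  privatization into a single pmf.\<close>

lemma data_law_bind:
  fixes K :: "nat \<Rightarrow> 'z pmf"
  assumes p: "p \<in> prob_vectors d"
  shows "data_law d p \<bind> (\<lambda>x. measure_pmf (K x)) = measure_pmf (bind_pmf (data_pmf d p) K)"
proof (rule measure_eqI)
  note ne = space_data_law_nonempty[OF p] and K = measurable_data_law_pmf[of K d p]
  show "sets (data_law d p \<bind> (\<lambda>x. measure_pmf (K x))) = sets (measure_pmf (bind_pmf (data_pmf d p) K))"
    using sets_bind[OF sets_kernel[OF K] ne] by simp
  fix A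
  have "emeasure (data_law d p \<bind> (\<lambda>x. measure_pmf (K x))) A = (\<integral>\<^sup>+x. emeasure (K x) A \<partial>data_law d p)"
    by (rule emeasure_bind[OF ne K]) simp
  also have "\<dots> = (\<Sum>x=1..d. ennreal (p x) * emeasure (K x) A)"
    by (simp add: data_law_def nn_integral_point_measure_finite)
  also have "\<dots> = (\<integral>\<^sup>+x. emeasure (K x) A \<partial>data_pmf d p)"
    using set_data_pmf[OF p]
    by (subst nn_integral_measure_pmf_support[of "{1..d}"]) (auto simp: pmf_data_pmf[OF p] mult.commute)
  finally show "emeasure (data_law d p \<bind> (\<lambda>x. measure_pmf (K x))) A =
      emeasure (measure_pmf (bind_pmf (data_pmf d p) K)) A" by simp
qed

text \<open>The kernel ignores both the index and the earlier outputs, so every step of the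
  recursion appends an independent observation with the same mixture law. The product measure is
  recognised by its values on boxes.\<close>

lemma private_law_eq_PiM:
  fixes K :: "nat \<Rightarrow> 'z pmf"
  assumes p: "p \<in> prob_vectors d"
  shows "private_law d p (count_space UNIV, \<lambda>i (x, z). measure_pmf (K x)) k =
    PiM {1..k} (\<lambda>_. measure_pmf (bind_pmf (data_pmf d p) K))"
proof (induction k)
  define P where "P = bind_pmf (data_pmf d p) K"
  interpret product_prob_space "\<lambda>_::nat. measure_pmf P" by unfold_locales
  have sets_P: "sets (PiM I (\<lambda>_. measure_pmf P)) = sets (PiM I (\<lambda>_. count_space UNIV))" for I :: "nat set"
    by (rule sets_PiM_cong) auto
  {
    \<comment> \<open>Both sides are the point mass at the only function with empty domain, which is
      \<open>undefined\<close> everywhere.\<close>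
    case 0
    have "return (PiM {} (\<lambda>_. count_space UNIV)) (\<lambda>_. undefined) = PiM {} (\<lambda>_::nat. measure_pmf P)"
      by (rule PiM_eqI) (auto simp: sets_P emeasure_return PiM_empty)
    then show ?case by (simp add: P_def)
  next
    case (Suc k)
    let ?I = "{1..k}" and ?J = "{1..Suc k}"
    let ?N = "PiM ?J (\<lambda>_. count_space (UNIV :: 'z set))"
    let ?L = "PiM ?I (\<lambda>_. measure_pmf P)"
    have J: "?J = insert (Suc k) ?I" by auto
    have upd: "(\<lambda>(z, y). z(Suc k := y)) \<in> ?L \<Otimes>\<^sub>M count_space UNIV \<rightarrow>\<^sub>M ?N"
      unfolding J measurable_cong_sets[OF sets_pair_measure_cong[OF sets_P refl] refl]
      by (rule measurable_add_dim)
    have upd1: "(\<lambda>y. z(Suc k := y)) \<in> count_space UNIV \<rightarrow>\<^sub>M ?N" if "z \<in> space ?L" for z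
      using measurable_Pair_compose_split[OF upd measurable_const[OF that] measurable_ident] by simp
    have ker: "(\<lambda>z. distr (measure_pmf P) ?N (\<lambda>y. z(Suc k := y))) \<in> ?L \<rightarrow>\<^sub>M subprob_algebra ?N"
      by (rule measurable_distr2[OF upd]) (simp add: measure_pmf_in_subprob_space)
    have neL: "space ?L \<noteq> {}" by (simp add: space_PiM PiE_eq_empty_iff)
    \<comment> \<open>Averaging over the raw observation commutes with appending the output, so the
      mixture collapses to the output law \<open>P\<close>.\<close>
    have inner: "data_law d p \<bind> (\<lambda>x. distr (measure_pmf (K x)) ?N (\<lambda>y. z(Suc k := y))) =
        distr (measure_pmf P) ?N (\<lambda>y. z(Suc k := y))" if "z \<in> space ?L" for z
    proof -
      show ?thesis
        using distr_bind[OF measurable_data_law_pmf space_data_law_nonempty[OF p] upd1[OF that], of K] data_law_bind[OF p, of K] by (simp add: P_def)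
    qed
    have "private_law d p (count_space UNIV, \<lambda>i (x, z). measure_pmf (K x)) (Suc k) =
        ?L \<bind> (\<lambda>z. data_law d p \<bind> (\<lambda>x. distr (measure_pmf (K x)) ?N (\<lambda>y. z(Suc k := y))))"
      using Suc by (simp add: P_def)
    also have "\<dots> = ?L \<bind> (\<lambda>z. distr (measure_pmf P) ?N (\<lambda>y. z(Suc k := y)))"
      by (rule bind_cong[OF refl inner]) auto
    also have "\<dots> = PiM ?J (\<lambda>_. measure_pmf P)"
    proof (rule PiM_eqI)
      show "finite ?J" by simp
      show "sets (?L \<bind> (\<lambda>z. distr (measure_pmf P) ?N (\<lambda>y. z(Suc k := y)))) = sets (PiM ?J (\<lambda>_. measure_pmf P))"
        using sets_bind[OF sets_kernel[OF ker] neL] sets_P by simp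
      fix A :: "nat \<Rightarrow> 'z set"
      have A: "Pi\<^sub>E ?J A \<in> sets ?N" by (rule sets_PiM_I_finite) auto
      have "emeasure (?L \<bind> (\<lambda>z. distr (measure_pmf P) ?N (\<lambda>y. z(Suc k := y)))) (Pi\<^sub>E ?J A) =
          (\<integral>\<^sup>+z. emeasure (distr (measure_pmf P) ?N (\<lambda>y. z(Suc k := y))) (Pi\<^sub>E ?J A) \<partial>?L)"
        by (rule emeasure_bind[OF neL ker A])
      also have "\<dots> = (\<integral>\<^sup>+z. emeasure (measure_pmf P) (A (Suc k)) * indicator (Pi\<^sub>E ?I A) z \<partial>?L)"
      proof (rule nn_integral_cong)
        fix z assume z: "z \<in> space ?L"
        \<comment> \<open>Appending \<open>y\<close> to \<open>z\<close> lands in the box exactly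
          when \<open>z\<close> lies in the box of the first \<open>k\<close> sides and
          \<open>y\<close> in the last side. Hence the mass of the box factors.\<close>
        then have "(\<lambda>y. z(Suc k := y)) -` Pi\<^sub>E ?J A = (if z \<in> Pi\<^sub>E ?I A then A (Suc k) else {})"
          unfolding J by (auto simp: space_PiM PiE_iff extensional_def)
        then show "emeasure (distr (measure_pmf P) ?N (\<lambda>y. z(Suc k := y))) (Pi\<^sub>E ?J A) =
            emeasure (measure_pmf P) (A (Suc k)) * indicator (Pi\<^sub>E ?I A) z"
          using upd1[OF z] A by (subst emeasure_distr) auto
      qed
      also have "\<dots> = emeasure (measure_pmf P) (A (Suc k)) * emeasure ?L (Pi\<^sub>E ?I A)"
        by (subst nn_integral_cmult_indicator) (auto intro!: sets_PiM_I_finite)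
      also have "emeasure ?L (Pi\<^sub>E ?I A) = (\<Prod>i\<in>?I. emeasure (measure_pmf P) (A i))"
        by (rule emeasure_PiM) auto
      also have "emeasure (measure_pmf P) (A (Suc k)) * \<dots> = (\<Prod>i\<in>?J. emeasure (measure_pmf P) (A i))"
        unfolding J by simp
      finally show "emeasure (?L \<bind> (\<lambda>z. distr (measure_pmf P) ?N (\<lambda>y. z(Suc k := y)))) (Pi\<^sub>E ?J A) =
          (\<Prod>i\<in>?J. emeasure (measure_pmf P) (A i))" .
    qed
    finally show ?case by (simp add: P_def)
  }
qed

subsection \<open>Biased random signs\<close>

text \<open>A sign vector is represented by the set of its positive coordinates, so a sum over all
  sign vectors on \<open>J\<close> is a sum over \<open>Pow J\<close>.\<close>

definition sign_at :: "'a set \<Rightarrow> 'a \<Rightarrow> real" where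
  "sign_at S j = (if j \<in> S then 1 else -1)"

text \<open>The involution \<open>\<phi>\<close> pairs terms that cancel. Negating all signs kills
  products of one or three signs, even with repeated indices; negating a single sign kills the
  product of two distinct ones.\<close>

lemma sum_Pow_antisymmetric:
  fixes F :: "'a set \<Rightarrow> real"
  assumes \<phi>: "\<And>S. S \<subseteq> J \<Longrightarrow> \<phi> S \<subseteq> J" "\<And>S. S \<subseteq> J \<Longrightarrow> \<phi> (\<phi> S) = S"
    and F: "\<And>S. S \<subseteq> J \<Longrightarrow> F (\<phi> S) = - F S"
  shows "(\<Sum>S\<in>Pow J. F S) = 0"
proof -
  have "(\<Sum>S\<in>Pow J. F S) = (\<Sum>S\<in>Pow J. F (\<phi> S))"
    by (rule sum.reindex_bij_witness[of _ \<phi> \<phi>]) (use \<phi> in auto)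
  also have "\<dots> = - (\<Sum>S\<in>Pow J. F S)"
    by (simp add: F sum_negf)
  finally show ?thesis by simp
qed

lemma sum_Pow_sign_at: "j \<in> J \<Longrightarrow> (\<Sum>S\<in>Pow J. sign_at S j) = 0"
  by (rule sum_Pow_antisymmetric[where \<phi> = "\<lambda>S. J - S"]) (auto simp: sign_at_def)

lemma sum_Pow_sign_at_mult:
  assumes "finite J" "j \<in> J" "k \<in> J"
  shows "(\<Sum>S\<in>Pow J. sign_at S j * sign_at S k) = (if j = k then 2 ^ card J else 0)"
proof (cases "j = k")
  case True
  then have "(\<Sum>S\<in>Pow J. sign_at S j * sign_at S k) = (\<Sum>S\<in>Pow J. 1)"
    by (intro sum.cong) (auto simp: sign_at_def)
  then show ?thesis using True assms by (simp add: card_Pow)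
next
  case False
  then have "(\<Sum>S\<in>Pow J. sign_at S j * sign_at S k) = 0"
    using assms
    \<comment> \<open>Toggling the membership of \<open>j\<close> negates the sign at
      \<open>j\<close> and leaves the one at \<open>k\<close> alone.\<close>
    by (intro sum_Pow_antisymmetric[where \<phi> = "\<lambda>S. sym_diff S {j}"]) (auto simp: sign_at_def)
  with False show ?thesis by simp
qed

lemma sum_Pow_sign_at_mult3:
  "\<lbrakk>j \<in> J; k \<in> J; l \<in> J\<rbrakk> \<Longrightarrow> (\<Sum>S\<in>Pow J. sign_at S j * sign_at S k * sign_at S l) = 0"
  by (rule sum_Pow_antisymmetric[where \<phi> = "\<lambda>S. J - S"]) (auto simp: sign_at_def)

definition biased_signs :: "'a set \<Rightarrow> real \<Rightarrow> 'a \<Rightarrow> 'a set pmf" where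
  "biased_signs J \<tau> i =
    embed_pmf (\<lambda>S. if S \<in> Pow J then (1 + \<tau> * sign_at S i) / 2 ^ card J else 0)"

context
  fixes J :: "'a set" and \<tau> :: real and i :: 'a
  assumes J: "finite J" and i: "i \<in> J" and \<tau>: "\<bar>\<tau>\<bar> \<le> 1"
begin

lemma pmf_biased_signs:
  "pmf (biased_signs J \<tau> i) S = (if S \<in> Pow J then (1 + \<tau> * sign_at S i) / 2 ^ card J else 0)"
  unfolding biased_signs_def
proof (rule pmf_embed_pmf)
  have nonneg: "0 \<le> (1 + \<tau> * sign_at S i) / 2 ^ card J" for S
    using \<tau> by (auto simp: sign_at_def)
  show "0 \<le> (if S \<in> Pow J then (1 + \<tau> * sign_at S i) / 2 ^ card J else 0)" for S
    using nonneg by simp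
  have "(\<integral>\<^sup>+S. ennreal (if S \<in> Pow J then (1 + \<tau> * sign_at S i) / 2 ^ card J else 0) \<partial>count_space UNIV) =
      (\<Sum>S\<in>Pow J. ennreal ((1 + \<tau> * sign_at S i) / 2 ^ card J))"
    using J by (subst nn_integral_count_space'[of "Pow J"]) auto
  also have "\<dots> = ennreal (\<Sum>S\<in>Pow J. (1 + \<tau> * sign_at S i) / 2 ^ card J)"
    by (rule sum_ennreal) (use nonneg in auto)
  also have "(\<Sum>S\<in>Pow J. (1 + \<tau> * sign_at S i) / 2 ^ card J) = 1"
    using J i by (simp add: sum_divide_distrib[symmetric] sum.distrib sum_distrib_left[symmetric]
        sum_Pow_sign_at card_Pow)
  finally show "(\<integral>\<^sup>+S. ennreal (if S \<in> Pow J then (1 + \<tau> * sign_at S i) / 2 ^ card J else 0)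
      \<partial>count_space UNIV) = 1" by simp
qed

lemma set_biased_signs: "set_pmf (biased_signs J \<tau> i) \<subseteq> Pow J"
  by (auto simp: set_pmf_iff pmf_biased_signs split: if_splits)

text \<open>The law is a linear tilt of the uniform one: the uniform mean of \<open>f\<close>, plus
  \<open>\<tau>\<close> times the uniform correlation of \<open>f\<close> with the sign at
  \<open>i\<close>.\<close>

lemma expectation_biased_signs:
  "measure_pmf.expectation (biased_signs J \<tau> i) f =
    ((\<Sum>S\<in>Pow J. f S) + \<tau> * (\<Sum>S\<in>Pow J. f S * sign_at S i)) / 2 ^ card J"
proof -
  have "measure_pmf.expectation (biased_signs J \<tau> i) f =
      (\<Sum>S\<in>Pow J. f S * ((1 + \<tau> * sign_at S i) / 2 ^ card J))"
    using set_biased_signs J by (subst integral_measure_pmf_real[of "Pow J"]) (auto simp: pmf_biased_signs)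
  also have "\<dots> = ((\<Sum>S\<in>Pow J. f S) + \<tau> * (\<Sum>S\<in>Pow J. f S * sign_at S i)) / 2 ^ card J"
    by (simp add: sum_divide_distrib[symmetric] sum.distrib[symmetric] sum_distrib_left algebra_simps)
  finally show ?thesis .
qed

lemma expectation_sign_at:
  "j \<in> J \<Longrightarrow> measure_pmf.expectation (biased_signs J \<tau> i) (\<lambda>S. sign_at S j) = (if j = i then \<tau> else 0)"
  using J i by (simp add: expectation_biased_signs sum_Pow_sign_at sum_Pow_sign_at_mult)

text \<open>The tilt contributes a product of three signs, which sums to zero. The second moments
  are therefore the same for every \<open>i\<close>, and later for every mixture over cells.\<close>

lemma expectation_sign_at_mult:
  "j \<in> J \<Longrightarrow> k \<in> J \<Longrightarrow>
    measure_pmf.expectation (biased_signs J \<tau> i) (\<lambda>S. sign_at S j * sign_at S k) = (if j = k then 1 else 0)"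
  using J i by (simp add: expectation_biased_signs sum_Pow_sign_at_mult sum_Pow_sign_at_mult3)

end

text \<open>The worst likelihood ratio between two cells is that of the weights
  \<open>1 + \<tau>\<close> and \<open>1 - \<tau>\<close>; the hypothesis on \<open>c\<close> states
  it without division.\<close>

lemma pmf_biased_signs_le:
  assumes "finite J" "i \<in> J" "i' \<in> J" "0 \<le> \<tau>" "\<tau> \<le> 1" and c: "1 + \<tau> \<le> c * (1 - \<tau>)" and "0 \<le> c"
  shows "pmf (biased_signs J \<tau> i) S \<le> c * pmf (biased_signs J \<tau> i') S"
proof -
  have "1 + \<tau> * sign_at S i \<le> 1 + \<tau>" using assms by (auto simp: sign_at_def)
  also note c
  also have "c * (1 - \<tau>) \<le> c * (1 + \<tau> * sign_at S i')"
    using assms by (intro mult_left_mono) (auto simp: sign_at_def)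
  finally show ?thesis
    using assms by (auto simp: pmf_biased_signs divide_right_mono)
qed

text \<open>Privacy is a condition on events; summing the pointwise bound over an event gives
  it.\<close>

lemma measure_pmf_le_mult:
  assumes "\<And>x. pmf p x \<le> c * pmf q x" and "0 \<le> c"
  shows "measure (measure_pmf p) A \<le> c * measure (measure_pmf q) A"
proof -
  have "emeasure (measure_pmf p) A \<le> (\<integral>\<^sup>+x. ennreal c * ennreal (pmf q x) \<partial>count_space A)"
    unfolding nn_integral_pmf[symmetric] using assms
    by (intro nn_integral_mono) (simp add: ennreal_mult[symmetric] ennreal_leI)
  also have "\<dots> = ennreal c * emeasure (measure_pmf q) A"
    by (simp add: nn_integral_cmult nn_integral_pmf)
  finally show ?thesis
    using assms(2) by (simp add: measure_pmf.emeasure_eq_measure ennreal_mult[symmetric])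
qed

subsection \<open>The sign mechanism and its test\<close>

text \<open>Cell \<open>0\<close>, which is not in \<open>{1..d}\<close>, stands for the whole complement of \<open>B\<close>.\<close>

definition cell :: "nat set \<Rightarrow> nat \<Rightarrow> nat" where
  "cell B x = (if x \<in> B then x else 0)"

definition cell_prob :: "nat \<Rightarrow> nat set \<Rightarrow> (nat \<Rightarrow> real) \<Rightarrow> nat \<Rightarrow> real" where
  "cell_prob d B p j = (\<Sum>x | x \<in> {1..d} \<and> cell B x = j. p x)"

lemma cell_prob_eq:
  assumes "B \<subseteq> {1..d}"
  shows "j \<in> B \<Longrightarrow> cell_prob d B p j = p j" and "cell_prob d B p 0 = (\<Sum>x\<in>{1..d} - B. p x)"
proof -
  show "cell_prob d B p j = p j" if "j \<in> B"
  proof -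
    have "{x \<in> {1..d}. cell B x = j} = {j}"
      using assms that by (auto simp: cell_def)
    then show ?thesis by (simp add: cell_prob_def)
  qed
  have "{x \<in> {1..d}. cell B x = 0} = {1..d} - B"
    using assms by (auto simp: cell_def)
  then show "cell_prob d B p 0 = (\<Sum>x\<in>{1..d} - B. p x)" by (simp add: cell_prob_def)
qed

text \<open>The cell probabilities form a probability vector, and \<open>q\<^sup>2 \<le> q\<close>
  on the unit interval.\<close>

lemma sum_cell_prob_power2_le:
  assumes "B \<subseteq> {1..d}" "p \<in> prob_vectors d"
  shows "(\<Sum>j\<in>insert 0 B. (cell_prob d B p j)\<^sup>2) \<le> 1"
proof -
  have fin: "finite B" and "0 \<notin> B" using assms finite_subset by auto
  have p: "0 \<le> p x" if "x \<in> {1..d}" for x using assms(2) that by (auto simp: prob_vectors_def)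
  have nonneg: "0 \<le> cell_prob d B p j" for j
    unfolding cell_prob_def by (rule sum_nonneg) (use p in auto)
  have sum1: "(\<Sum>j\<in>insert 0 B. cell_prob d B p j) = 1"
    using assms fin \<open>0 \<notin> B\<close> sum.subset_diff[OF assms(1), of p]
    by (simp add: cell_prob_eq prob_vectors_def add.commute)
  have le1: "cell_prob d B p j \<le> 1" if "j \<in> insert 0 B" for j
    using member_le_sum[OF that, of "cell_prob d B p"] nonneg fin sum1 by auto
  have "(\<Sum>j\<in>insert 0 B. (cell_prob d B p j)\<^sup>2) \<le> (\<Sum>j\<in>insert 0 B. cell_prob d B p j)"
    by (intro sum_mono) (simp add: power2_eq_square mult_left_le nonneg le1)
  with sum1 show ?thesis by simp
qed

text \<open>\<open>C\<close> is the covariance matrix of the signs divided by \<open>\<tau>\<close>: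
  a multiple of the identity minus a rank one matrix. Its quadratic form loses a square. In the sum
  of squared entries the cross term \<open>2 / \<tau>\<^sup>2 * Q\<close> outweighs
  \<open>Q * Q\<close>, because \<open>Q\<close> and \<open>\<tau>\<close> are at most 1.\<close>

lemma
  fixes \<mu> q :: "'j \<Rightarrow> real"
  assumes "finite J" and q: "(\<Sum>j\<in>J. (q j)\<^sup>2) \<le> 1" and \<tau>: "0 < \<tau>" "\<tau> \<le> 1"
  defines "C \<equiv> \<lambda>j k. (if j = k then 1 / \<tau>\<^sup>2 else 0) - q j * q k"
  shows quadratic_form_sign_covariance_le: "(\<Sum>j\<in>J. \<Sum>k\<in>J. \<mu> j * \<mu> k * C j k) \<le> (\<Sum>j\<in>J. (\<mu> j)\<^sup>2) / \<tau>\<^sup>2"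
    and sum_sign_covariance_power2_le: "(\<Sum>j\<in>J. \<Sum>k\<in>J. (C j k)\<^sup>2) \<le> real (card J) / \<tau> ^ 4"
proof -
  have "(\<Sum>j\<in>J. \<Sum>k\<in>J. \<mu> j * \<mu> k * C j k) =
      (\<Sum>j\<in>J. \<Sum>k\<in>J. (if j = k then (\<mu> j)\<^sup>2 / \<tau>\<^sup>2 else 0) - (\<mu> j * q j) * (\<mu> k * q k))"
    unfolding C_def by (intro sum.cong refl) (auto simp: algebra_simps power2_eq_square)
  also have "\<dots> = (\<Sum>j\<in>J. (\<mu> j)\<^sup>2) / \<tau>\<^sup>2 - (\<Sum>j\<in>J. \<mu> j * q j)\<^sup>2"
    using \<open>finite J\<close> by (simp add: sum_subtractf sum_divide_distrib power2_eq_square sum_product)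
  finally show "(\<Sum>j\<in>J. \<Sum>k\<in>J. \<mu> j * \<mu> k * C j k) \<le> (\<Sum>j\<in>J. (\<mu> j)\<^sup>2) / \<tau>\<^sup>2" by simp
  define Q where "Q = (\<Sum>j\<in>J. (q j)\<^sup>2)"
  have Q: "0 \<le> Q" "Q \<le> 1" using q by (auto simp: Q_def sum_nonneg)
  have "(\<Sum>j\<in>J. \<Sum>k\<in>J. (C j k)\<^sup>2) =
      (\<Sum>j\<in>J. \<Sum>k\<in>J. (if j = k then 1 / \<tau> ^ 4 - 2 / \<tau>\<^sup>2 * (q j)\<^sup>2 else 0) + (q j)\<^sup>2 * (q k)\<^sup>2)"
    unfolding C_def by (intro sum.cong refl) (auto simp: power2_eq_square power4_eq_xxxx algebra_simps)
  also have "\<dots> = real (card J) / \<tau> ^ 4 - 2 / \<tau>\<^sup>2 * Q + Q * Q"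
  proof -
    have "Q * Q = (\<Sum>j\<in>J. \<Sum>k\<in>J. (q j)\<^sup>2 * (q k)\<^sup>2)" "2 / \<tau>\<^sup>2 * Q = (\<Sum>j\<in>J. 2 / \<tau>\<^sup>2 * (q j)\<^sup>2)"
      unfolding Q_def by (rule sum_product, rule sum_distrib_left)
    then show ?thesis
      using \<open>finite J\<close> by (simp add: sum.distrib sum_subtractf)
  qed
  also have "\<dots> \<le> real (card J) / \<tau> ^ 4"
  proof -
    have "Q * Q \<le> 1 * Q" using Q by (intro mult_right_mono) auto
    also have "\<dots> \<le> 2 / \<tau>\<^sup>2 * Q"
      using \<tau> Q by (intro mult_right_mono) (auto simp: divide_simps power_le_one intro: order.trans[of _ 1])
    finally show ?thesis by simp
  qed
  finally show "(\<Sum>j\<in>J. \<Sum>k\<in>J. (C j k)\<^sup>2) \<le> real (card J) / \<tau> ^ 4" .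
qed

text \<open>The injection \<open>e\<close> encodes the sign vectors, which are given by their sets of positive coordinates, in
  the output type.\<close>

locale sign_mechanism =
  fixes d :: nat and B :: "nat set" and \<tau> :: real and e :: "nat set \<Rightarrow> 'z"
  assumes B: "B \<subseteq> {1..d}" and \<tau>: "0 < \<tau>" "\<tau> \<le> 1" and e: "inj_on e (Pow (insert 0 B))"
begin

abbreviation J :: "nat set" where "J \<equiv> insert 0 B"

definition kernel :: "nat \<Rightarrow> 'z pmf" where
  "kernel x = map_pmf e (biased_signs J \<tau> (cell B x))"

definition mech :: "'z mechanism" where
  "mech = (count_space UNIV, \<lambda>i (x, z). measure_pmf (kernel x))"

text \<open>Decodes an output. Off the image of \<open>e\<close>, which has probability zero, the
  decoded set is arbitrary, but the value is still 1 or -1, so bounds hold everywhere.\<close>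

definition sgn_of :: "nat \<Rightarrow> 'z \<Rightarrow> real" where
  "sgn_of j z = sign_at (inv_into (Pow J) e z) j"

definition out_pmf :: "(nat \<Rightarrow> real) \<Rightarrow> 'z pmf" where
  "out_pmf p = bind_pmf (data_pmf d p) kernel"

lemma finite_J: "finite J" and zero_notin_B: "0 \<notin> B" and cell_in_J: "cell B x \<in> J"
  using B finite_subset by (auto simp: cell_def)

lemma card_J: "card J = card B + 1"
  using finite_J zero_notin_B by simp

lemma abs_\<tau>: "\<bar>\<tau>\<bar> \<le> 1"
  using \<tau> by simp

lemma mech_in_ni_ldp_mechanisms:
  assumes c: "1 + \<tau> \<le> exp \<alpha> * (1 - \<tau>)"
  shows "mech \<in> ni_ldp_mechanisms d N \<alpha>"
proof -
  have pmf_le: "pmf (kernel x) y \<le> exp \<alpha> * pmf (kernel x') y" for x x' y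
  proof (cases "y \<in> e ` Pow J")
    case True
    then obtain S where S: "S \<in> Pow J" "y = e S" by auto
    have "pmf (kernel x) y = pmf (biased_signs J \<tau> (cell B x)) S" for x
    proof -
      \<comment> \<open>The encoding is injective on \<open>Pow J\<close>, and any other preimage of
        \<open>y\<close> lies outside \<open>Pow J\<close> and carries no mass.\<close>
      have "measure (biased_signs J \<tau> (cell B x)) (e -` {y}) = measure (biased_signs J \<tau> (cell B x)) {S}"
        using set_biased_signs[OF finite_J cell_in_J abs_\<tau>, of x] S e
        by (intro measure_pmf.finite_measure_eq_AE) (auto simp: AE_measure_pmf_iff dest: inj_onD)
      then show ?thesis by (simp add: kernel_def pmf_map pmf.rep_eq)
    qed
    then show ?thesis
      using pmf_biased_signs_le[OF finite_J cell_in_J[of x] cell_in_J[of x'] _ \<tau>(2) c, of S] \<tau> by simp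
  next
    case False
    then have "y \<notin> set_pmf (kernel x)" for x
      using set_biased_signs[OF finite_J cell_in_J abs_\<tau>, of x] by (auto simp: kernel_def)
    then show ?thesis by (simp add: set_pmf_iff)
  qed
  have meas: "(\<lambda>(x, z). measure_pmf (kernel x)) \<in>
      count_space {1..d} \<Otimes>\<^sub>M PiM I (\<lambda>_. count_space UNIV) \<rightarrow>\<^sub>M prob_algebra (count_space UNIV)" for I :: "nat set"
    unfolding case_prod_beta
    by (rule measurable_compose[OF measurable_fst])
      (auto simp: space_prob_algebra prob_space_measure_pmf)
  show ?thesis
    unfolding mech_def ni_ldp_mechanisms_def ldp_mechanisms_def
    using meas by (auto intro!: measure_pmf_le_mult pmf_le)
qed

lemma private_law_mech:
  "p \<in> prob_vectors d \<Longrightarrow> private_law d p mech k = PiM {1..k} (\<lambda>_. measure_pmf (out_pmf p))"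
  unfolding mech_def out_pmf_def by (rule private_law_eq_PiM)

text \<open>Decoding undoes encoding almost surely, so an expectation under the output law is a
  mixture, over raw observations, of expectations under the biased signs.\<close>

lemma expectation_out_pmf:
  assumes "p \<in> prob_vectors d"
  shows "measure_pmf.expectation (out_pmf p) (\<lambda>z. f (inv_into (Pow J) e z)) =
    (\<Sum>x=1..d. p x * measure_pmf.expectation (biased_signs J \<tau> (cell B x)) f)"
proof -
  have fin: "finite (set_pmf (biased_signs J \<tau> (cell B x)))" for x
    using set_biased_signs[OF finite_J cell_in_J abs_\<tau>, of x] finite_J finite_subset by blast
  have "measure_pmf.expectation (kernel x) (\<lambda>z. f (inv_into (Pow J) e z)) =
      measure_pmf.expectation (biased_signs J \<tau> (cell B x)) f" for x
    unfolding kernel_def integral_map_pmf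
    using set_biased_signs[OF finite_J cell_in_J abs_\<tau>, of x] e
    by (intro integral_cong_AE) (auto simp: AE_measure_pmf_iff intro!: arg_cong[of _ _ f] inv_into_f_f)
  then show ?thesis
    unfolding out_pmf_def using fin set_data_pmf[OF assms]
    by (subst pmf_expectation_bind[of "{1..d}"]) (auto simp: pmf_data_pmf[OF assms] kernel_def)
qed

lemma expectation_sgn_of:
  assumes "p \<in> prob_vectors d" "j \<in> J"
  shows "measure_pmf.expectation (out_pmf p) (sgn_of j) = \<tau> * cell_prob d B p j"
proof -
  have "measure_pmf.expectation (out_pmf p) (sgn_of j) = (\<Sum>x=1..d. p x * (if j = cell B x then \<tau> else 0))"
    unfolding sgn_of_def expectation_out_pmf[OF assms(1), of "\<lambda>S. sign_at S j"]
    by (simp only: expectation_sign_at[OF finite_J cell_in_J abs_\<tau> assms(2)])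
  also have "\<dots> = (\<Sum>x | x \<in> {1..d} \<and> cell B x = j. p x * \<tau>)"
    by (intro sum.mono_neutral_cong_right) auto
  finally show ?thesis by (simp add: cell_prob_def sum_distrib_left mult.commute)
qed

lemma expectation_sgn_of_mult:
  assumes "p \<in> prob_vectors d" "j \<in> J" "k \<in> J"
  shows "measure_pmf.expectation (out_pmf p) (\<lambda>z. sgn_of j z * sgn_of k z) = (if j = k then 1 else 0)"
proof -
  have "measure_pmf.expectation (out_pmf p) (\<lambda>z. sgn_of j z * sgn_of k z) =
      (\<Sum>x=1..d. p x * (if j = k then 1 else 0))"
    unfolding sgn_of_def expectation_out_pmf[OF assms(1), of "\<lambda>S. sign_at S j * sign_at S k"]
    by (simp only: expectation_sign_at_mult[OF finite_J cell_in_J abs_\<tau> assms(2,3)])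
  also have "\<dots> = (if j = k then 1 else 0)"
    using assms(1) by (simp add: prob_vectors_def)
  finally show ?thesis .
qed

text \<open>Division by \<open>\<tau>\<close> removes the attenuation of the signs, so the score
  estimates the cell difference without bias and is centred under the null.\<close>

definition score :: "(nat \<Rightarrow> real) \<Rightarrow> nat \<Rightarrow> 'z \<Rightarrow> real" where
  "score p0 j z = sgn_of j z / \<tau> - cell_prob d B p0 j"

text \<open>The sums are not averaged, so the mean is \<open>n\<^sup>2\<close> times the squared
  cell distance. Products only pair observations of different halves, which keeps the noise variance
  out of the mean.\<close>

definition stat :: "nat \<Rightarrow> (nat \<Rightarrow> real) \<Rightarrow> (nat \<Rightarrow> 'z) \<Rightarrow> real" where
  "stat n p0 z = (\<Sum>j\<in>J. (\<Sum>i\<in>{1..n}. score p0 j (z i)) * (\<Sum>i\<in>{n+1..2*n}. score p0 j (z i)))"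

lemma abs_sgn_of: "\<bar>sgn_of j z\<bar> = 1"
  by (simp add: sgn_of_def sign_at_def)

lemma abs_score_le: "\<bar>score p0 j z\<bar> \<le> 1 / \<tau> + \<bar>cell_prob d B p0 j\<bar>"
  using abs_triangle_ineq4[of "sgn_of j z / \<tau>" "cell_prob d B p0 j"] \<tau>
  by (simp add: score_def abs_divide abs_sgn_of)

lemma integrable_out_pmf [simp]:
  shows "integrable (measure_pmf (out_pmf p)) (sgn_of j)"
    and "integrable (measure_pmf (out_pmf p)) (\<lambda>z. sgn_of j z * sgn_of k z)"
  by (auto intro!: measure_pmf.integrable_const_bound[where B = 1] simp: abs_mult abs_sgn_of)

lemma expectation_score:
  assumes "p \<in> prob_vectors d" "j \<in> J"
  shows "measure_pmf.expectation (out_pmf p) (score p0 j) = cell_prob d B p j - cell_prob d B p0 j"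
  using assms \<tau> unfolding score_def[abs_def] by (simp add: expectation_sgn_of)

text \<open>The product of the means is split off to expose the covariance, which depends on
  \<open>p\<close> only and not on the centring \<open>p0\<close>.\<close>

lemma expectation_score_mult:
  assumes "p \<in> prob_vectors d" "j \<in> J" "k \<in> J"
  shows "measure_pmf.expectation (out_pmf p) (\<lambda>z. score p0 j z * score p0 k z) =
    (cell_prob d B p j - cell_prob d B p0 j) * (cell_prob d B p k - cell_prob d B p0 k)
    + ((if j = k then 1 / \<tau>\<^sup>2 else 0) - cell_prob d B p j * cell_prob d B p k)"
proof -
  let ?q = "cell_prob d B p0"
  have "(\<lambda>z. score p0 j z * score p0 k z) =
      (\<lambda>z. sgn_of j z * sgn_of k z / \<tau>\<^sup>2 - sgn_of j z * (?q k / \<tau>) - sgn_of k z * (?q j / \<tau>) + ?q j * ?q k)"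
    by (auto simp: score_def power2_eq_square algebra_simps)
  then have "measure_pmf.expectation (out_pmf p) (\<lambda>z. score p0 j z * score p0 k z) =
     (if j = k then 1 else 0) / \<tau>\<^sup>2 - \<tau> * cell_prob d B p j * (?q k / \<tau>)
       - \<tau> * cell_prob d B p k * (?q j / \<tau>) + ?q j * ?q k"
    using assms by (simp add: expectation_sgn_of_mult expectation_sgn_of)
  then show ?thesis using \<tau> by (auto simp: algebra_simps)
qed

lemma stat_moments:
  fixes p p0 :: "nat \<Rightarrow> real"
  assumes p: "p \<in> prob_vectors d" and "n \<ge> 1"
  defines "M \<equiv> private_law d p mech (2 * n)"
    and "s \<equiv> \<Sum>j\<in>J. (cell_prob d B p j - cell_prob d B p0 j)\<^sup>2"
  shows "prob_space M" and "stat n p0 \<in> borel_measurable M"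
    and "integrable M (\<lambda>z. (stat n p0 z)\<^sup>2)"
    and "(\<integral>z. stat n p0 z \<partial>M) = (real n)\<^sup>2 * s"
    and "(\<integral>z. (stat n p0 z - (\<integral>z. stat n p0 z \<partial>M))\<^sup>2 \<partial>M) \<le>
      2 * real n ^ 3 * s / \<tau>\<^sup>2 + (real n)\<^sup>2 * real (card J) / \<tau> ^ 4"
proof -
  let ?P = "measure_pmf (out_pmf p)"
  let ?A = "{1..n}" and ?A' = "{n+1..2*n}"
  have M: "M = PiM (?A \<union> ?A') (\<lambda>_. ?P)"
    unfolding M_def private_law_mech[OF p] by (rule arg_cong[of _ _ "\<lambda>I. PiM I _"]) auto
  interpret PP: product_prob_space "\<lambda>_::nat. ?P" "?A \<union> ?A'" by unfold_locales
  have "prob_space (PiM (?A \<union> ?A') (\<lambda>_. ?P))"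
    by (rule prob_space_PiM) (rule prob_space_measure_pmf)
  then interpret MP: prob_space M unfolding M .
  show "prob_space M" by unfold_locales
  have indep: "MP.indep_vars (\<lambda>_. ?P) (\<lambda>i \<omega>. \<omega> i) (?A \<union> ?A')"
    unfolding M by (rule PP.indep_vars_coordinate) (use \<open>n \<ge> 1\<close> in auto)
  have comp: "(\<lambda>\<omega>. \<omega> i) \<in> M \<rightarrow>\<^sub>M ?P" "distr M ?P (\<lambda>\<omega>. \<omega> i) = ?P" if "i \<in> ?A \<union> ?A'" for i
    unfolding M by (rule measurable_component_singleton[OF that], rule PP.PiM_component[OF that])
  \<comment> \<open>A function of a single coordinate has the same integral under the product
    measure as under the output law.\<close>
  have pull: "integrable M (\<lambda>\<omega>. f (\<omega> i)) \<longleftrightarrow> integrable ?P f" "MP.expectation (\<lambda>\<omega>. f (\<omega> i)) = measure_pmf.expectation (out_pmf p) f"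
    if "i \<in> ?A \<union> ?A'" for i and f :: "'z \<Rightarrow> real"
    using integrable_distr_eq[OF comp(1)[OF that], of f] integral_distr[OF comp(1)[OF that], of f]
      comp(2)[OF that] by simp_all
  have int1: "integrable ?P (score p0 j)" for j
    by (auto intro!: measure_pmf.integrable_const_bound[where B = "1 / \<tau> + \<bar>cell_prob d B p0 j\<bar>"] abs_score_le)
  have int2: "integrable ?P (\<lambda>z. score p0 j z * score p0 k z)" for j k
    by (intro measure_pmf.integrable_const_bound[where
          B = "(1 / \<tau> + \<bar>cell_prob d B p0 j\<bar>) * (1 / \<tau> + \<bar>cell_prob d B p0 k\<bar>)"])
      (use \<tau> in \<open>auto simp: abs_mult intro!: AE_I2 mult_mono abs_score_le\<close>)
  define C where "C j k = (if j = k then 1 / \<tau>\<^sup>2 else 0) - cell_prob d B p j * cell_prob d B p k" for j k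
  have intM1: "integrable M (\<lambda>\<omega>. score p0 j (\<omega> i))"
    and meanM1: "j \<in> J \<Longrightarrow> MP.expectation (\<lambda>\<omega>. score p0 j (\<omega> i)) = cell_prob d B p j - cell_prob d B p0 j"
    if "i \<in> ?A \<union> ?A'" for i j
    using pull[OF that, of "score p0 j"] int1 expectation_score[OF p] by auto
  have intM2: "integrable M (\<lambda>\<omega>. score p0 j (\<omega> i) * score p0 k (\<omega> i))"
    and meanM2: "j \<in> J \<Longrightarrow> k \<in> J \<Longrightarrow> MP.expectation (\<lambda>\<omega>. score p0 j (\<omega> i) * score p0 k (\<omega> i)) =
      (cell_prob d B p j - cell_prob d B p0 j) * (cell_prob d B p k - cell_prob d B p0 k) + C j k"
    if "i \<in> ?A \<union> ?A'" for i j k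
    using pull[OF that, of "\<lambda>z. score p0 j z * score p0 k z"] int2 expectation_score_mult[OF p]
    by (auto simp only: C_def)
  have prem: "?A \<inter> ?A' = {}" "finite ?A" "finite ?A'" "card ?A = n" "card ?A' = n"
    "score p0 j \<in> borel_measurable ?P" for j by auto
  note mom = MP.split_inner_product_moments[where g = "score p0" and C = C, OF indep prem(1) finite_J prem(2-6)
      intM1 intM2 meanM1 meanM2, folded stat_def s_def]
  show "integrable M (\<lambda>z. (stat n p0 z)\<^sup>2)" "stat n p0 \<in> borel_measurable M"
    "(\<integral>z. stat n p0 z \<partial>M) = (real n)\<^sup>2 * s" using mom(1-3) by auto
  have "2 * real n ^ 3 * (\<Sum>j\<in>J. \<Sum>k\<in>J. (cell_prob d B p j - cell_prob d B p0 j) * (cell_prob d B p k - cell_prob d B p0 k) * C j k)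
      \<le> 2 * real n ^ 3 * (s / \<tau>\<^sup>2)"
    unfolding C_def s_def
    by (intro mult_left_mono quadratic_form_sign_covariance_le finite_J \<tau> sum_cell_prob_power2_le B p) auto
  moreover have "(real n)\<^sup>2 * (\<Sum>j\<in>J. \<Sum>k\<in>J. (C j k)\<^sup>2) \<le> (real n)\<^sup>2 * (real (card J) / \<tau> ^ 4)"
    unfolding C_def
    by (intro mult_left_mono sum_sign_covariance_power2_le finite_J \<tau> sum_cell_prob_power2_le B p) auto
  ultimately show "MP.variance (stat n p0) \<le> 2 * real n ^ 3 * s / \<tau>\<^sup>2 + (real n)\<^sup>2 * real (card J) / \<tau> ^ 4"
    using mom(4) by simp
qed

text \<open>\<open>V\<close> bounds the variance of the statistic. Under the null the ratio is
  \<open>\<gamma>\<^sup>2 / 100\<close>. For \<open>s \<ge> 2 t\<close> it decreases in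
  \<open>s\<close>, and at \<open>s = 2 t\<close> the signal part is at most
  \<open>2 \<gamma> / 5\<close> and the noise part is \<open>\<gamma>\<^sup>2 / 100\<close>; the
  factor 10 in \<open>t\<close> lets their sum fit under \<open>\<gamma> / 2\<close>.\<close>

lemma error_bound_of_threshold:
  fixes n m :: nat and \<gamma> s :: real
  assumes "n \<ge> 1" "m \<ge> 1" "0 < \<gamma>" "\<gamma> \<le> 1"
  defines "t \<equiv> 10 * sqrt (real m) / (\<tau>\<^sup>2 * real n * \<gamma>)"
  defines "V \<equiv> \<lambda>s. 2 * real n ^ 3 * s / \<tau>\<^sup>2 + (real n)\<^sup>2 * real m / \<tau> ^ 4"
  shows "V 0 / ((real n)\<^sup>2 * t)\<^sup>2 \<le> \<gamma> / 2"
    and "2 * t \<le> s \<Longrightarrow> V s / ((real n)\<^sup>2 * s / 2)\<^sup>2 \<le> \<gamma> / 2"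
proof -
  have pos: "0 < real n" "0 < t" "1 \<le> sqrt (real m)"
    using assms \<tau> by (auto simp: t_def)
  have noise: "real m / (\<tau> ^ 4 * (real n)\<^sup>2 * t\<^sup>2) = \<gamma>\<^sup>2 / 100"
    using assms(1-4) \<tau>
    by (simp add: t_def power_divide power_mult_distrib field_simps power2_eq_square power4_eq_xxxx)
  have "\<gamma>\<^sup>2 \<le> \<gamma>" using assms by (simp add: power2_eq_square mult_left_le)
  have V0: "V 0 / ((real n)\<^sup>2 * t)\<^sup>2 = real m / (\<tau> ^ 4 * (real n)\<^sup>2 * t\<^sup>2)"
    using pos \<tau> by (simp add: V_def field_simps power2_eq_square)
  show "V 0 / ((real n)\<^sup>2 * t)\<^sup>2 \<le> \<gamma> / 2"
    unfolding V0 noise using \<open>\<gamma>\<^sup>2 \<le> \<gamma>\<close> \<open>0 < \<gamma>\<close> by simp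
  assume s: "2 * t \<le> s"
  then have "0 < s" using pos by simp
  have "V s / ((real n)\<^sup>2 * s / 2)\<^sup>2 = 8 / (real n * \<tau>\<^sup>2 * s) + 4 * real m / (\<tau> ^ 4 * (real n)\<^sup>2 * s\<^sup>2)"
    using pos \<tau> \<open>0 < s\<close> by (simp add: V_def field_simps power2_eq_square power3_eq_cube power4_eq_xxxx)
  also have "\<dots> \<le> 8 / (real n * \<tau>\<^sup>2 * (2 * t)) + 4 * real m / (\<tau> ^ 4 * (real n)\<^sup>2 * (2 * t)\<^sup>2)"
    using pos \<tau> s by (intro add_mono divide_left_mono mult_left_mono power_mono mult_pos_pos) auto
  also have "\<dots> = 4 / (real n * \<tau>\<^sup>2 * t) + \<gamma>\<^sup>2 / 100"
    unfolding noise[symmetric] by (simp add: power_mult_distrib mult_ac)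
  also have "4 / (real n * \<tau>\<^sup>2 * t) = 2 * \<gamma> / (5 * sqrt (real m))"
    using pos \<tau> assms(1-4) by (simp add: t_def field_simps)
  also have "\<dots> \<le> 2 * \<gamma> / 5"
    using pos \<open>0 < \<gamma>\<close> by (intro divide_left_mono) auto
  also have "2 * \<gamma> / 5 + \<gamma>\<^sup>2 / 100 \<le> \<gamma> / 2"
    using \<open>\<gamma>\<^sup>2 \<le> \<gamma>\<close> \<open>0 < \<gamma>\<close> by simp
  finally show "V s / ((real n)\<^sup>2 * s / 2)\<^sup>2 \<le> \<gamma> / 2" by simp
qed

text \<open>The test rejects when the statistic reaches \<open>n\<^sup>2 * t\<close>; Chebyshev's
  inequality leaves each of the two errors at most \<open>\<gamma> / 2\<close>.\<close>

lemma test_risk_mech_le: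
  fixes n :: nat and \<gamma> \<delta> :: real
  assumes p0: "p0 \<in> prob_vectors d" and n: "n \<ge> 1" and \<gamma>: "0 < \<gamma>" "\<gamma> \<le> 1"
  defines "t \<equiv> 10 * sqrt (real (card J)) / (\<tau>\<^sup>2 * real n * \<gamma>)"
  assumes sep: "\<And>p. p \<in> alternatives d r p0 \<delta> \<Longrightarrow>
    2 * t \<le> (\<Sum>j\<in>J. (cell_prob d B p j - cell_prob d B p0 j)\<^sup>2)"
  shows "test_risk d (2 * n) r p0 \<delta> mech \<le> ennreal \<gamma>"
proof -
  define u where "u = (real n)\<^sup>2 * t"
  define \<phi> :: "(nat \<Rightarrow> 'z) \<Rightarrow> real" where "\<phi> z = indicator {z. u \<le> stat n p0 z} z" for z
  have m: "card J \<ge> 1" using card_J by simp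
  have t: "0 < t" using \<tau> n \<gamma> m card_J by (simp add: t_def)
  have u: "0 < u" using t n by (simp add: u_def)
  note err = error_bound_of_threshold[OF n m \<gamma>, folded t_def]
  have sets_law: "sets (private_law d p0 mech (2 * n)) = sets (PiM {1..2 * n} (\<lambda>_. fst mech))"
    unfolding private_law_mech[OF p0] by (rule sets_PiM_cong) (auto simp: mech_def)
  have "stat n p0 \<in> borel_measurable (PiM {1..2 * n} (\<lambda>_. fst mech))"
    using stat_moments(2)[OF p0 n, of p0] unfolding measurable_cong_sets[OF sets_law refl] .
  then have test: "\<phi> \<in> tests (2 * n) mech"
    unfolding tests_def \<phi>_def by (auto intro!: borel_measurable_indicator' simp: indicator_def)
  have type1: "(\<integral>z. \<phi> z \<partial>private_law d p0 mech (2 * n)) \<le> \<gamma> / 2"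
  proof -
    let ?M = "private_law d p0 mech (2 * n)"
    interpret MP: prob_space ?M using stat_moments(1)[OF p0 n] .
    note mom = stat_moments(2-5)[OF p0 n, of p0]
    note [measurable] = mom(1)
    have "(\<integral>z. \<phi> z \<partial>?M) = MP.prob {z \<in> space ?M. u \<le> stat n p0 z}"
      unfolding \<phi>_def by (simp add: Collect_conj_eq Int_commute)
    \<comment> \<open>Under the null the mean is zero, so a rejection is a deviation by at least
      \<open>u\<close>.\<close>
    also have "\<dots> \<le> MP.prob {z \<in> space ?M. u \<le> \<bar>stat n p0 z - MP.expectation (stat n p0)\<bar>}"
      by (intro MP.finite_measure_mono) (auto simp: mom(3))
    also have "\<dots> \<le> MP.variance (stat n p0) / u\<^sup>2"
      by (rule MP.Chebyshev_inequality[OF mom(1,2) u])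
    also have "\<dots> \<le> \<gamma> / 2"
      by (rule order.trans[OF divide_right_mono err(1)[folded u_def]]) (use mom(4) in simp_all)
    finally show ?thesis .
  qed
  have type2: "(\<integral>z. 1 - \<phi> z \<partial>private_law d p mech (2 * n)) \<le> \<gamma> / 2" if p: "p \<in> alternatives d r p0 \<delta>" for p
  proof -
    let ?M = "private_law d p mech (2 * n)"
    define s where "s = (\<Sum>j\<in>J. (cell_prob d B p j - cell_prob d B p0 j)\<^sup>2)"
    have pv: "p \<in> prob_vectors d" using p by (simp add: alternatives_def)
    interpret MP: prob_space ?M using stat_moments(1)[OF pv n] .
    note mom = stat_moments(2-5)[OF pv n, of p0, folded s_def]
    note [measurable] = mom(1)
    have s: "2 * t \<le> s" using sep[OF p] by (simp add: s_def)
    let ?a = "(real n)\<^sup>2 * s / 2"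
    have a: "0 < ?a" using s t n by simp
    \<comment> \<open>The separation puts the threshold at or below half the mean, so an acceptance
      deviates from the mean by at least half of it.\<close>
    have ua: "u \<le> ?a" using mult_left_mono[OF s, of "(real n)\<^sup>2"] by (simp add: u_def)
    have "(\<integral>z. 1 - \<phi> z \<partial>?M) = (\<integral>z. indicator {z. stat n p0 z < u} z \<partial>?M)"
      by (intro Bochner_Integration.integral_cong) (auto simp: \<phi>_def indicator_def)
    also have "\<dots> = MP.prob {z \<in> space ?M. stat n p0 z < u}"
      by (simp add: Collect_conj_eq Int_commute)
    also have "\<dots> \<le> MP.prob {z \<in> space ?M. ?a \<le> \<bar>stat n p0 z - MP.expectation (stat n p0)\<bar>}"
    proof (intro MP.finite_measure_mono)
      have "?a \<le> \<bar>x - MP.expectation (stat n p0)\<bar>" if "x < u" for x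
        unfolding mom(3) using that ua by linarith
      then show "{z \<in> space ?M. stat n p0 z < u} \<subseteq>
          {z \<in> space ?M. ?a \<le> \<bar>stat n p0 z - MP.expectation (stat n p0)\<bar>}" by blast
    qed auto
    also have "\<dots> \<le> MP.variance (stat n p0) / ?a\<^sup>2"
      by (rule MP.Chebyshev_inequality[OF mom(1,2) a])
    also have "\<dots> \<le> \<gamma> / 2"
      by (rule order.trans[OF divide_right_mono err(2)[OF s]]) (use mom(4) in simp_all)
    finally show ?thesis .
  qed
  have "test_risk d (2 * n) r p0 \<delta> mech \<le> (SUP p\<in>alternatives d r p0 \<delta>.
      ennreal ((\<integral>z. \<phi> z \<partial>private_law d p0 mech (2 * n)) + (\<integral>z. 1 - \<phi> z \<partial>private_law d p mech (2 * n))))"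
    unfolding test_risk_def using test by (rule INF_lower)
  also have "\<dots> \<le> ennreal \<gamma>"
    by (rule SUP_least, rule ennreal_leI) (use type1 type2 in fastforce)
  finally show ?thesis .
qed

end

section \<open>From separated cell probabilities to the testing radius\<close>

lemma ni_testing_radius_le:
  fixes \<gamma> \<alpha> \<delta> :: real and d n r :: nat and p0 :: "nat \<Rightarrow> real" and B :: "nat set"
  assumes inf: "infinite (UNIV :: 'z set)" and \<gamma>: "0 < \<gamma>" "\<gamma> \<le> 1" and n: "n \<ge> 1"
    and p0: "p0 \<in> prob_vectors d" and \<alpha>: "0 < \<alpha>" "\<alpha> \<le> 1" and sub: "B \<subseteq> {1..d}" and nonempty: "B \<noteq> {}" and "0 < \<delta>"
    and sep: "\<And>p. p \<in> alternatives d r p0 \<delta> \<Longrightarrow> 360 * (sqrt (real (card B)) / (real n * \<alpha>\<^sup>2 * \<gamma>))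
      \<le> (\<Sum>j\<in>insert 0 B. (cell_prob d B p j - cell_prob d B p0 j)\<^sup>2)"
  shows "ni_testing_radius TYPE('z) \<gamma> d (2 * n) \<alpha> r p0 \<le> ennreal \<delta>"
proof -
  have finB: "finite B" using sub finite_subset by auto
  \<comment> \<open>An infinite output type has room for all sign vectors, which supplies the
    encoding \<open>e\<close>.\<close>
  obtain F :: "'z set" where "finite F" "card F = card (Pow (insert 0 B))"
    using infinite_arbitrarily_large[OF inf] by metis
  then obtain e where "bij_betw e (Pow (insert 0 B)) F"
    using finite_same_card_bij[of "Pow (insert 0 B)" F] finB by auto
  then have e: "inj_on e (Pow (insert 0 B))" by (simp add: bij_betw_def)
  interpret sign_mechanism d B "\<alpha> / 3" e
    by unfold_locales (use \<alpha> sub e in auto)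
  \<comment> \<open>The right side exceeds the left by \<open>\<alpha> * (1 - \<alpha>) / 3\<close>;
    this is where \<open>\<alpha> \<le> 1\<close> enters the privacy bound.\<close>
  have "1 + \<alpha> / 3 \<le> (1 + \<alpha>) * (1 - \<alpha> / 3)"
    using \<alpha> by (simp add: field_simps power2_eq_square mult_left_le)
  also have "\<dots> \<le> exp \<alpha> * (1 - \<alpha> / 3)"
    using \<alpha> by (intro mult_right_mono exp_ge_add_one_self) auto
  finally have mech: "mech \<in> ni_ldp_mechanisms d (2 * n) \<alpha>"
    by (rule mech_in_ni_ldp_mechanisms)
  have "sqrt (real (card J)) \<le> sqrt (4 * real (card B))"
  proof (intro real_sqrt_le_mono)
    have "0 < card B" using nonempty finB by (simp add: card_gt_0_iff)
    then show "real (card J) \<le> 4 * real (card B)" unfolding card_J by simp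
  qed
  then have "sqrt (real (card J)) \<le> 2 * sqrt (real (card B))"
    by (simp add: real_sqrt_mult)
  \<comment> \<open>Here \<open>360 = 2 * 10 * 9 * 2\<close>: the separation \<open>2 * t\<close>,
    the 10 in \<open>t\<close>, the square of \<open>\<alpha> / 3\<close>, and the passage from
    \<open>card J\<close> to \<open>card B\<close>.\<close>
  then have "2 * (10 * sqrt (real (card J)) / ((\<alpha> / 3)\<^sup>2 * real n * \<gamma>)) \<le>
      360 * (sqrt (real (card B)) / (real n * \<alpha>\<^sup>2 * \<gamma>))"
    using \<alpha> n \<gamma> by (simp add: field_simps)
  then have "test_risk d (2 * n) r p0 \<delta> mech \<le> ennreal \<gamma>"
    using sep by (intro test_risk_mech_le[OF p0 n \<gamma>]) (meson order.trans)
  then have "ni_minimax_risk TYPE('z) d (2 * n) \<alpha> r p0 \<delta> \<le> ennreal \<gamma>"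
    unfolding ni_minimax_risk_def by (rule INF_lower2[OF mech])
  then show ?thesis
    unfolding ni_testing_radius_def using \<open>0 < \<delta>\<close> by (intro INF_lower) auto
qed

text \<open>On \<open>B\<close> the cell differences are the differences themselves. Off
  \<open>B\<close>, the triangle inequality leaves the two tail masses, whose sum is
  \<open>D 0 + 2 * w\<close>. Cauchy-Schwarz over the \<open>card B + 1\<close> cells then gives the
  first bound. For the second, the Euclidean norm of the tail is at most its absolute sum.\<close>

lemma
  fixes p p0 :: "nat \<Rightarrow> real"
  assumes B: "B \<subseteq> {1..d}" and p: "p \<in> prob_vectors d" and p0: "p0 \<in> prob_vectors d"
  defines "w \<equiv> \<Sum>x\<in>{1..d} - B. p0 x"
    and "s \<equiv> \<Sum>j\<in>insert 0 B. (cell_prob d B p j - cell_prob d B p0 j)\<^sup>2"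
  shows l1_distance_le_cell_distance: "lr_norm d 1 (\<lambda>j. p j - p0 j) \<le> sqrt (real (card B + 1) * s) + 2 * w"
    and l2_distance_le_cell_distance: "(lr_norm d 2 (\<lambda>j. p j - p0 j))\<^sup>2 \<le> 2 * s + 8 * w\<^sup>2"
proof -
  define D where "D j = cell_prob d B p j - cell_prob d B p0 j" for j
  have fin: "finite B" and z: "0 \<notin> B" using B finite_subset by auto
  have DB: "p j - p0 j = D j" if "j \<in> B" for j
    using that by (simp add: D_def cell_prob_eq[OF B])
  have split: "(\<Sum>j=1..d. f j) = (\<Sum>j\<in>B. f j) + (\<Sum>j\<in>{1..d} - B. f j)" for f :: "nat \<Rightarrow> real"
    using sum.subset_diff[OF B, of f] by simp
  have "(\<Sum>j\<in>{1..d} - B. \<bar>p j - p0 j\<bar>) \<le> (\<Sum>j\<in>{1..d} - B. p j + p0 j)"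
    using p p0 by (intro sum_mono) (auto simp: prob_vectors_def abs_le_iff)
  also have "\<dots> = D 0 + 2 * w"
    by (simp add: D_def w_def cell_prob_eq[OF B] sum.distrib)
  finally have tail: "(\<Sum>j\<in>{1..d} - B. \<bar>p j - p0 j\<bar>) \<le> \<bar>D 0\<bar> + 2 * w" by simp
  have s: "s = (\<Sum>j\<in>B. (D j)\<^sup>2) + (D 0)\<^sup>2"
    using fin z by (simp add: s_def D_def)
  have l1: "lr_norm d 1 (\<lambda>j. p j - p0 j) = (\<Sum>j=1..d. \<bar>p j - p0 j\<bar>)"
    and l2: "(lr_norm d 2 (\<lambda>j. p j - p0 j))\<^sup>2 = (\<Sum>j=1..d. (p j - p0 j)\<^sup>2)"
    by (simp_all add: lr_norm_def sqrt_def[symmetric] sum_nonneg)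
  have "lr_norm d 1 (\<lambda>j. p j - p0 j) = (\<Sum>j\<in>B. \<bar>D j\<bar>) + (\<Sum>j\<in>{1..d} - B. \<bar>p j - p0 j\<bar>)"
    unfolding l1 split by (simp add: DB)
  also have "\<dots> \<le> (\<Sum>j\<in>insert 0 B. \<bar>D j\<bar>) + 2 * w"
    using tail fin z by simp
  also have "(\<Sum>j\<in>insert 0 B. \<bar>D j\<bar>) \<le> sqrt (real (card B + 1) * s)"
  proof (rule real_le_rsqrt)
    have "(\<Sum>j\<in>insert 0 B. 1 * \<bar>D j\<bar>)\<^sup>2 \<le> (\<Sum>j\<in>insert 0 B. 1\<^sup>2) * (\<Sum>j\<in>insert 0 B. \<bar>D j\<bar>\<^sup>2)"
      by (rule Cauchy_Schwarz_ineq_sum)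
    then show "(\<Sum>j\<in>insert 0 B. \<bar>D j\<bar>)\<^sup>2 \<le> real (card B + 1) * s"
      using fin z by (simp add: s add.commute)
  qed
  finally show "lr_norm d 1 (\<lambda>j. p j - p0 j) \<le> sqrt (real (card B + 1) * s) + 2 * w" by simp
  have w: "0 \<le> w"
    unfolding w_def using p0 by (intro sum_nonneg) (auto simp: prob_vectors_def)
  have "(lr_norm d 2 (\<lambda>j. p j - p0 j))\<^sup>2 = (\<Sum>j\<in>B. (D j)\<^sup>2) + (\<Sum>j\<in>{1..d} - B. (p j - p0 j)\<^sup>2)"
    unfolding l2 split by (simp add: DB)
  also have "(\<Sum>j\<in>{1..d} - B. (p j - p0 j)\<^sup>2) \<le> (\<Sum>j\<in>{1..d} - B. \<bar>p j - p0 j\<bar>)\<^sup>2"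
    using power_mono[OF L2_set_le_sum_abs[of "\<lambda>j. p j - p0 j" "{1..d} - B"] L2_set_nonneg, of 2]
    by (simp add: L2_set_def sum_nonneg)
  also have "\<dots> \<le> (\<bar>D 0\<bar> + 2 * w)\<^sup>2"
    using tail by (intro power_mono) (auto intro: sum_nonneg)
  also have "\<dots> \<le> 2 * (D 0)\<^sup>2 + 8 * w\<^sup>2"
    using zero_le_power2[of "\<bar>D 0\<bar> - 2 * w"] by (simp add: power2_sum power2_diff power_mult_distrib)
  also have "(\<Sum>j\<in>B. (D j)\<^sup>2) + (2 * (D 0)\<^sup>2 + 8 * w\<^sup>2) \<le> 2 * s + 8 * w\<^sup>2"
    using sum_nonneg[of B "\<lambda>j. (D j)\<^sup>2"] by (simp add: s)
  finally show "(lr_norm d 2 (\<lambda>j. p j - p0 j))\<^sup>2 \<le> 2 * s + 8 * w\<^sup>2" by simp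
qed

text \<open>Squaring turns the fourth root into \<open>sqrt X\<close>, which dominates
  \<open>Y\<close>. The constants are \<open>96 = 8 * 12\<close>, from the radius, and its square
  9216.\<close>

lemma power2_ge_of_powr_quarter:
  fixes \<delta> X Y :: real
  assumes "96 * X powr (1 / 4) \<le> \<delta>" "Y\<^sup>2 \<le> X" "0 \<le> Y"
  shows "9216 * Y \<le> \<delta>\<^sup>2"
proof -
  have "0 \<le> X" using assms(2) zero_le_power2[of Y] by linarith
  have "Y \<le> sqrt X" using assms by (intro real_le_rsqrt)
  also have "sqrt X = (X powr (1 / 4))\<^sup>2"
    using \<open>0 \<le> X\<close> by (simp add: powr_half_sqrt[symmetric] power2_eq_square powr_add[symmetric])
  finally have "9216 * Y \<le> (96 * X powr (1 / 4))\<^sup>2" by (simp add: power_mult_distrib)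
  also have "\<dots> \<le> \<delta>\<^sup>2" using assms(1) by (intro power_mono) auto
  finally show ?thesis .
qed

theorem theorem1:
  fixes \<gamma> \<alpha> :: real and d n :: nat and p0 :: "nat \<Rightarrow> real" and B :: "nat set"
  assumes "infinite (UNIV :: 'z set)"
    and "0 < \<gamma>" and "\<gamma> < 1"
    and "d \<ge> 1" and "n \<ge> 2"
    and "p0 \<in> prob_vectors d"
    and "0 < \<alpha>" and "\<alpha> \<le> 1"
    and "B \<subseteq> {1..d}" and "B \<noteq> {}"
  shows "ni_testing_radius TYPE('z) \<gamma> d (2 * n) \<alpha> 1 p0
           \<le> ennreal (8 * max
               (12 * (real (card B) ^ 3 / (real n * (real n - 1) * \<alpha> ^ 4 * \<gamma>\<^sup>2)) powr (1 / 4))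
               (\<Sum>j\<in>{1..d} - B. p0 j))
       \<and> ni_testing_radius TYPE('z) \<gamma> d (2 * n) \<alpha> 2 p0
           \<le> ennreal (8 * max
               (12 * (real (card B) / (real n * (real n - 1) * \<alpha> ^ 4 * \<gamma>\<^sup>2)) powr (1 / 4))
               (\<Sum>j\<in>{1..d} - B. p0 j))"
proof
  define b where "b = real (card B)"
  define w where "w = (\<Sum>j\<in>{1..d} - B. p0 j)"
  \<comment> \<open>The order of separation required by \<open>ni_testing_radius_le\<close>: the
    squared cell distance has to reach \<open>360 * y\<close>.\<close>
  define y where "y = sqrt b / (real n * \<alpha>\<^sup>2 * \<gamma>)"
  have "finite B" using assms(9) finite_subset by auto
  then have b: "1 \<le> b" using assms(10) by (simp add: b_def Suc_le_eq card_gt_0_iff)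
  have y: "0 < y" using b assms by (simp add: y_def)
  have w: "0 \<le> w"
    unfolding w_def using assms(6) by (intro sum_nonneg) (auto simp: prob_vectors_def)
  \<comment> \<open>Replacing one factor \<open>n\<close> by the smaller \<open>n - 1\<close> in the
    denominator matches the form of the radius. It serves for \<open>c = b ^ 3\<close> and for
    \<open>c = b\<close>.\<close>
  have X: "(sqrt c / (real n * \<alpha>\<^sup>2 * \<gamma>))\<^sup>2 \<le> c / (real n * (real n - 1) * \<alpha> ^ 4 * \<gamma>\<^sup>2)" if "0 < c" for c
  proof -
    have "(sqrt c / (real n * \<alpha>\<^sup>2 * \<gamma>))\<^sup>2 = c / (real n * real n * \<alpha> ^ 4 * \<gamma>\<^sup>2)"
      using that by (simp add: power_divide power_mult_distrib power2_eq_square power4_eq_xxxx mult_ac)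
    also have "\<dots> \<le> c / (real n * (real n - 1) * \<alpha> ^ 4 * \<gamma>\<^sup>2)"
      using that assms by (intro divide_left_mono mult_right_mono mult_left_mono mult_pos_pos) auto
    finally show ?thesis .
  qed
  note radius = ni_testing_radius_le[OF assms(1,2) less_imp_le[OF assms(3)] _ assms(6,7,8,9,10), of n, folded b_def, folded y_def]
  {
    define \<delta> where "\<delta> = 8 * max (12 * (b ^ 3 / (real n * (real n - 1) * \<alpha> ^ 4 * \<gamma>\<^sup>2)) powr (1 / 4)) w"
    have \<delta>1: "96 * (b ^ 3 / (real n * (real n - 1) * \<alpha> ^ 4 * \<gamma>\<^sup>2)) powr (1 / 4) \<le> \<delta>" and \<delta>2: "8 * w \<le> \<delta>"
      by (auto simp: \<delta>_def)
    have "0 < 96 * (b ^ 3 / (real n * (real n - 1) * \<alpha> ^ 4 * \<gamma>\<^sup>2)) powr (1 / 4)"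
      using b assms by simp
    with \<delta>1 have "0 < \<delta>" by linarith
    have "sqrt (b ^ 3) / (real n * \<alpha>\<^sup>2 * \<gamma>) = b * y"
      using b by (simp add: y_def power3_eq_cube real_sqrt_mult)
    with power2_ge_of_powr_quarter[OF \<delta>1 X] b y have big: "9216 * (b * y) \<le> \<delta>\<^sup>2" by simp
    show "ni_testing_radius TYPE('z) \<gamma> d (2 * n) \<alpha> 1 p0 \<le> ennreal (8 * max
               (12 * (real (card B) ^ 3 / (real n * (real n - 1) * \<alpha> ^ 4 * \<gamma>\<^sup>2)) powr (1 / 4))
               (\<Sum>j\<in>{1..d} - B. p0 j))"
      unfolding b_def[symmetric] w_def[symmetric] \<delta>_def[symmetric]
    proof (rule radius)
      show "n \<ge> 1" "0 < \<delta>" using assms \<open>0 < \<delta>\<close> by auto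
      fix p assume p: "p \<in> alternatives d 1 p0 \<delta>"
      define s where "s = (\<Sum>j\<in>insert 0 B. (cell_prob d B p j - cell_prob d B p0 j)\<^sup>2)"
      have "0 \<le> s" by (simp add: s_def sum_nonneg)
      have "\<delta> \<le> sqrt ((b + 1) * s) + 2 * w"
        using p l1_distance_le_cell_distance[OF assms(9) _ assms(6), of p]
        by (simp add: alternatives_def s_def w_def b_def add.commute)
      \<comment> \<open>The tail term satisfies \<open>2 * w \<le> \<delta> / 4\<close>, so three
        quarters of the separation remain for the cells.\<close>
      then have "3 / 4 * \<delta> \<le> sqrt ((b + 1) * s)" using \<delta>2 by linarith
      then have "(3 / 4 * \<delta>)\<^sup>2 \<le> (sqrt ((b + 1) * s))\<^sup>2"
        using \<open>0 < \<delta>\<close> by (intro power_mono) auto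
      then have "9 / 16 * \<delta>\<^sup>2 \<le> (b + 1) * s"
        using b \<open>0 \<le> s\<close> by (simp add: power_mult_distrib power_divide)
      also have "\<dots> \<le> (2 * b) * s" using b \<open>0 \<le> s\<close> by (intro mult_right_mono) auto
      also have "\<dots> = 2 * (b * s)" by simp
      \<comment> \<open>The available constant is \<open>9 / 32 * 9216 = 2592\<close>.\<close>
      finally have "360 * (b * y) \<le> b * s"
        using big b y mult_pos_pos[of b y] by linarith
      then have "b * (360 * y) \<le> b * s" by (simp only: mult.left_commute)
      then show "360 * y \<le> s" by (rule mult_left_le_imp_le) (use b in simp)
    qed
  }
  {
    define \<delta> where "\<delta> = 8 * max (12 * (b / (real n * (real n - 1) * \<alpha> ^ 4 * \<gamma>\<^sup>2)) powr (1 / 4)) w"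
    have \<delta>1: "96 * (b / (real n * (real n - 1) * \<alpha> ^ 4 * \<gamma>\<^sup>2)) powr (1 / 4) \<le> \<delta>" and \<delta>2: "8 * w \<le> \<delta>"
      by (auto simp: \<delta>_def)
    have "0 < 96 * (b / (real n * (real n - 1) * \<alpha> ^ 4 * \<gamma>\<^sup>2)) powr (1 / 4)"
      using b assms by simp
    with \<delta>1 have "0 < \<delta>" by linarith
    have big: "9216 * y \<le> \<delta>\<^sup>2"
      using power2_ge_of_powr_quarter[OF \<delta>1 X] b y by (simp add: y_def)
    show "ni_testing_radius TYPE('z) \<gamma> d (2 * n) \<alpha> 2 p0 \<le> ennreal (8 * max
               (12 * (real (card B) / (real n * (real n - 1) * \<alpha> ^ 4 * \<gamma>\<^sup>2)) powr (1 / 4))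
               (\<Sum>j\<in>{1..d} - B. p0 j))"
      unfolding b_def[symmetric] w_def[symmetric] \<delta>_def[symmetric]
    proof (rule radius)
      show "n \<ge> 1" "0 < \<delta>" using assms \<open>0 < \<delta>\<close> by auto
      fix p assume p: "p \<in> alternatives d 2 p0 \<delta>"
      define s where "s = (\<Sum>j\<in>insert 0 B. (cell_prob d B p j - cell_prob d B p0 j)\<^sup>2)"
      have "\<delta>\<^sup>2 \<le> (lr_norm d 2 (\<lambda>j. p j - p0 j))\<^sup>2"
        using p \<open>0 < \<delta>\<close> by (intro power_mono) (auto simp: alternatives_def)
      also have "\<dots> \<le> 2 * s + 8 * w\<^sup>2"
        using p l2_distance_le_cell_distance[OF assms(9) _ assms(6), of p]
        by (simp add: alternatives_def s_def w_def)
      also have "8 * w\<^sup>2 \<le> \<delta>\<^sup>2 / 8"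
        using power_mono[OF \<delta>2, of 2] w by (simp add: power_mult_distrib)
      \<comment> \<open>The tail costs one eighth of \<open>\<delta>\<^sup>2\<close>, and half of
        the remaining seven eighths bounds \<open>s\<close> from below;
        \<open>7 / 16 * 9216 = 4032\<close> exceeds 360.\<close>
      finally have "7 / 16 * \<delta>\<^sup>2 \<le> s" by simp
      then show "360 * y \<le> s" using big y by simp
    qed
  }
qed

end
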